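(* Let $k\ge 2$ be fixed, let $\mathbb F$ be a finite field, fix an integer $\ell$ with $n/2\ge \ell\ge k$, and fix $\varepsilon\in(0,1)$. There is an algorithm that takes as input a $k$-$\mathrm{LIN}(\mathbb F)$ instance $\mathcal I=(\mathcal H,\{b_v\}_{v\in\mathcal H})$ in $n$ variables and outputs a number $\mathrm{alg\text{-}val}(\mathcal I)\in[0,1]$ in time $(|\mathbb F|n)^{O(\ell)}$ with the following guarantees, where $C$ is a constant independent of $n,\ell,|\mathbb F|,\varepsilon$: 1. $\mathrm{alg\text{-}val}(\mathcal I)\ge\mathrm{val}(\mathcal I)$ for every instance $\mathcal I$; 2. if $|\mathcal H|\ge C\,n\cdot\left(\frac{n}{\ell}\right)^{k-1}\cdot\log(|\mathbb F|n)\cdot\varepsilon^{-2}$ and $\mathcal I$ is drawn from the fully random distribution, then with probability at least $1-\frac1{\mathrm{poly}(n)}$ over the draw of the instance, $\mathrm{alg\text{-}val}(\mathcal I)\le\frac1{|\mathbb F|}+\varepsilon$; 3. if $|\mathcal H|\ge C\,n\cdot\left(\frac{n}{\ell}\right)^{k-1}\cdot\log(|\mathbb F|n)\cdot\varepsilon^{-3}$ and $\mathcal I$ is drawn from the semirandom distribution, then with probability at least $1-\frac1{\mathrm{poly}(n)}$ over the randomness of $\{b_v\}_{v\in\mathcal H}$, $\mathrm{alg\text{-}val}(\mathcal I)\le\frac1{|\mathbb F|}+\varepsilon$.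
   Context: A vector $v\in\mathbb F^n$ is $k$-sparse if exactly $k$ of its coordinates are nonzero. A $k$-$\mathrm{LIN}(\mathbb F)$ instance is $\mathcal I=(\mathcal H,\{b_v\}_{v\in\mathcal H})$ where $\mathcal H$ is a set of $k$-sparse vectors in $\mathbb F^n$ and $b_v\in\mathbb F$, representing the equations $\sum_i v_ix_i=b_v$; $\mathrm{val}(\mathcal I)=\max_{x\in\mathbb F^n}\frac1{|\mathcal H|}\sum_{v\in\mathcal H}\mathbf 1(\sum_iv_ix_i=b_v)$. The instance is random if $\mathcal H$ is a uniformly random subset (of the given size) of the $k$-sparse vectors and each $b_v$ is independent and uniform in $\mathbb F$; it is semirandom if $\mathcal H$ is arbitrary and each $b_v$ is independent and uniform in $\mathbb F$. *)

theory Defs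
  imports "HOL-Algebra.Ring" "HOL-Probability.Probability" "HOL-Library.Log_Nat"
begin

section \<open>Random access machines with logarithmic cost\<close>

text \<open>
  Programs for a random access machine with registers and an indirectly addressed memory, both
  holding natural numbers of arbitrary size. Every operation is charged the bit lengths of all
  numbers and addresses it touches (the logarithmic cost criterion), so that running times agree
  with those of Turing machines up to a polynomial, even though multiplication is primitive.
\<close>

datatype expr =
    Const nat
  | Reg nat
  | Mem expr
  | Plus expr expr
  | Minus expr expr
  | Times expr expr
  | Div expr expr

datatype prog =
    Skip
  | SetReg nat expr
  | SetMem expr expr
  | Seq prog prog
  | Cond expr prog prog
  | While expr prog

record state =
  regs :: "nat \<Rightarrow> nat"
  mem :: "nat \<Rightarrow> nat"

definition len :: "nat \<Rightarrow> nat" where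
  "len m = Suc (floorlog 2 m)"

text \<open>Subtraction is truncated at 0; division rounds down, and division by 0 yields 0.\<close>

primrec eval :: "expr \<Rightarrow> state \<Rightarrow> nat" where
  "eval (Const m) s = m"
| "eval (Reg r) s = regs s r"
| "eval (Mem e) s = mem s (eval e s)"
| "eval (Plus e f) s = eval e s + eval f s"
| "eval (Minus e f) s = eval e s - eval f s"
| "eval (Times e f) s = eval e s * eval f s"
| "eval (Div e f) s = eval e s div eval f s"

primrec cost :: "expr \<Rightarrow> state \<Rightarrow> nat" where
  "cost (Const m) s = len m"
| "cost (Reg r) s = len r + len (regs s r)"
| "cost (Mem e) s = cost e s + len (eval e s) + len (mem s (eval e s))"
| "cost (Plus e f) s = cost e s + cost f s + len (eval e s) + len (eval f s)"
| "cost (Minus e f) s = cost e s + cost f s + len (eval e s) + len (eval f s)"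
| "cost (Times e f) s = cost e s + cost f s + len (eval e s) + len (eval f s)"
| "cost (Div e f) s = cost e s + cost f s + len (eval e s) + len (eval f s)"

text \<open>\<open>exec P s t s'\<close>: started in \<open>s\<close>, program \<open>P\<close> halts in \<open>s'\<close> after time \<open>t\<close>.\<close>

inductive exec :: "prog \<Rightarrow> state \<Rightarrow> nat \<Rightarrow> state \<Rightarrow> bool" where
  Skip: "exec Skip s 1 s"
| SetReg: "exec (SetReg r e) s (cost e s + len r + len (eval e s))
             (s\<lparr>regs := (regs s)(r := eval e s)\<rparr>)"
| SetMem: "exec (SetMem a e) s (cost a s + cost e s + len (eval a s) + len (eval e s))
             (s\<lparr>mem := (mem s)(eval a s := eval e s)\<rparr>)"
| Seq: "exec P s t s' \<Longrightarrow> exec Q s' u s'' \<Longrightarrow> exec (Seq P Q) s (t + u) s''"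
| CondTrue: "eval e s \<noteq> 0 \<Longrightarrow> exec P s t s' \<Longrightarrow>
             exec (Cond e P Q) s (cost e s + len (eval e s) + t) s'"
| CondFalse: "eval e s = 0 \<Longrightarrow> exec Q s t s' \<Longrightarrow>
             exec (Cond e P Q) s (cost e s + len (eval e s) + t) s'"
| WhileTrue: "eval e s \<noteq> 0 \<Longrightarrow> exec P s t s' \<Longrightarrow> exec (While e P) s' u s'' \<Longrightarrow>
             exec (While e P) s (cost e s + len (eval e s) + t + u) s''"
| WhileFalse: "eval e s = 0 \<Longrightarrow> exec (While e P) s (cost e s + len (eval e s)) s"

lemma exec_deterministic:
  "exec P s t s' \<Longrightarrow> exec P s u s'' \<Longrightarrow> t = u \<and> s' = s''"
proof (induction arbitrary: u s'' rule: exec.induct)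
  case (Skip s)
  from Skip.prems show ?case by cases simp_all
next
  case (SetReg r e s)
  from SetReg.prems show ?case by cases simp_all
next
  case (SetMem a e s)
  from SetMem.prems show ?case by cases simp_all
next
  case (Seq P s t s' Q v s1)
  from Seq.prems show ?case by cases (use Seq.IH in blast)
next
  case (CondTrue e s P t s' Q)
  from CondTrue.prems show ?case
    by cases (use CondTrue.hyps CondTrue.IH in blast)+
next
  case (CondFalse e s Q t s' P)
  from CondFalse.prems show ?case
    by cases (use CondFalse.hyps CondFalse.IH in blast)+
next
  case (WhileTrue e s P t s' v s1)
  from WhileTrue.prems show ?case
    by cases (use WhileTrue.hyps WhileTrue.IH in blast)+
next
  case (WhileFalse e s P)
  from WhileFalse.prems show ?case
    by cases (use WhileFalse.hyps in blast)+
qed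

definition initial :: "nat list \<Rightarrow> state" where
  "initial xs = \<lparr>regs = (\<lambda>_. 0), mem = (\<lambda>i. if i < length xs then xs ! i else 0)\<rparr>"

text \<open>The output is the rational number with numerator in register 0, denominator in register 1.\<close>

definition outputs_within :: "prog \<Rightarrow> nat list \<Rightarrow> real \<Rightarrow> nat \<Rightarrow> bool" where
  "outputs_within P xs y T \<longleftrightarrow>
     (\<exists>t s. exec P (initial xs) t s \<and> t \<le> T \<and> regs s 1 > 0 \<and>
            y = real (regs s 0) / real (regs s 1))"


section \<open>Sparse linear equations over a finite field\<close>

text \<open>
  The elements of the field are numbered \<open>0, \<dots>, |F| - 1\<close>. Every finite field is isomorphic to one
  of this form, and the numbering is how field elements are presented to a machine; it need not be
  related to the algebraic structure (the zero of the field need not have number 0). Having the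
  fields as values of one type, instead of as types, permits constants that do not depend on the
  field.
\<close>

definition finite_field :: "nat ring \<Rightarrow> bool" where
  "finite_field F \<longleftrightarrow> field F \<and> (\<exists>q. carrier F = {..<q})"

abbreviation field_size :: "nat ring \<Rightarrow> nat" where
  "field_size F \<equiv> card (carrier F)"

definition vectors :: "nat ring \<Rightarrow> nat \<Rightarrow> (nat \<Rightarrow> nat) set" where
  "vectors F n = {..<n} \<rightarrow>\<^sub>E carrier F"

definition sparse_vectors :: "nat ring \<Rightarrow> nat \<Rightarrow> nat \<Rightarrow> (nat \<Rightarrow> nat) set" where
  "sparse_vectors F n k = {v \<in> vectors F n. card {i \<in> {..<n}. v i \<noteq> \<zero>\<^bsub>F\<^esub>} = k}"

type_synonym LIN = "(nat \<Rightarrow> nat) set \<times> ((nat \<Rightarrow> nat) \<Rightarrow> nat)"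

definition LIN_instances :: "nat ring \<Rightarrow> nat \<Rightarrow> nat \<Rightarrow> LIN set" where
  "LIN_instances F n k = (SIGMA H : Pow (sparse_vectors F n k). H \<rightarrow>\<^sub>E carrier F)"

text \<open>The value of the instance without equations is 0, since division by 0 yields 0.\<close>

definition LIN_val :: "nat ring \<Rightarrow> nat \<Rightarrow> LIN \<Rightarrow> real" where
  "LIN_val F n = (\<lambda>(H, b). MAX x \<in> vectors F n.
     1 / real (card H) * (\<Sum>v\<in>H. of_bool ((\<Oplus>\<^bsub>F\<^esub>i\<in>{..<n}. v i \<otimes>\<^bsub>F\<^esub> x i) = b v)))"

definition semirandom_LIN :: "nat ring \<Rightarrow> (nat \<Rightarrow> nat) set \<Rightarrow> LIN pmf" where
  "semirandom_LIN F H =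
     map_pmf (\<lambda>b. (H, b)) (Pi_pmf H undefined (\<lambda>_. pmf_of_set (carrier F)))"

text \<open>Meaningful only if there are at least \<open>m\<close> sparse vectors.\<close>

definition random_LIN :: "nat ring \<Rightarrow> nat \<Rightarrow> nat \<Rightarrow> nat \<Rightarrow> LIN pmf" where
  "random_LIN F n k m =
     bind_pmf (pmf_of_set {H. H \<subseteq> sparse_vectors F n k \<and> card H = m}) (semirandom_LIN F)"

text \<open>
  What a machine is given: \<open>n\<close>, the parameter \<open>l\<close>, the field by its addition and multiplication
  tables, and the equations, the left-hand sides being listed in the order \<open>vs\<close>.
\<close>

definition encode :: "nat ring \<Rightarrow> nat \<Rightarrow> nat \<Rightarrow> (nat \<Rightarrow> nat) list \<Rightarrow> ((nat \<Rightarrow> nat) \<Rightarrow> nat) \<Rightarrow> nat list"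
  where
  "encode F n l vs b =
     [n, l, field_size F]
     @ [x \<oplus>\<^bsub>F\<^esub> y. x \<leftarrow> [0..<field_size F], y \<leftarrow> [0..<field_size F]]
     @ [x \<otimes>\<^bsub>F\<^esub> y. x \<leftarrow> [0..<field_size F], y \<leftarrow> [0..<field_size F]]
     @ [length vs]
     @ concat (map (\<lambda>v. map v [0..<n] @ [b v]) vs)"

text \<open>
  On every instance, program \<open>P\<close> outputs \<open>alg I\<close> within time \<open>T\<close>. As \<open>H\<close> is a set, the output must
  not depend on the order in which the equations are listed.
\<close>

definition computes_within ::
  "prog \<Rightarrow> nat ring \<Rightarrow> nat \<Rightarrow> nat \<Rightarrow> nat \<Rightarrow> (LIN \<Rightarrow> real) \<Rightarrow> nat \<Rightarrow> bool" where
  "computes_within P F n k l alg T \<longleftrightarrow>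
     (\<forall>(H, b) \<in> LIN_instances F n k. \<forall>vs. distinct vs \<and> set vs = H \<longrightarrow>
        outputs_within P (encode F n l vs b) (alg (H, b)) T)"

end

theory Submission imports Defs begin

text \<open>
  Up to a constant depending on \<open>k\<close>, the required number of equations is
  \<open>l * (n / l) ^ k * log (|F| n)\<close> divided by a power of \<open>\<epsilon>\<close>, and at this density brute force on
  groups of \<open>l\<close> variables suffices. Cut the variables into \<open>O(k n / l)\<close> blocks of \<open>l div k\<close>
  variables each, and sort the equations into classes according to the sequence of blocks in which
  their \<open>k\<close> variables lie. A class involves at most \<open>l\<close> variables, so the largest number of its
  equations that can be satisfied at once is found by trying all \<open>|F| ^ l\<close> assignments. The sum of
  these numbers over the \<open>O(k n / l) ^ k\<close> classes, divided by the number of equations, bounds the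
  value from above. If the right-hand sides are random, then by Hoeffding's inequality and a union
  bound over classes and assignments, in each class of size \<open>h\<close> the optimum exceeds \<open>h / |F|\<close> by at
  most \<open>sqrt (2 h l log (|F| n))\<close>; by the Cauchy-Schwarz inequality these deviations sum to at most
  \<open>\<epsilon> |H|\<close>. This holds for every choice of left-hand sides, so the fully random case is an
  average over semirandom ones.
\<close>

section \<open>A timed program logic\<close>

lemma len_le:
  assumes "x < 2 ^ b"
  shows "len x \<le> b + 1"
proof -
  have "floorlog 2 x \<le> b"
    by (rule floorlog_leI) (use assms in auto)
  then show ?thesis
    by (simp add: len_def)
qed

definition confined :: "nat \<Rightarrow> state \<Rightarrow> bool" where
  "confined L s \<longleftrightarrow> (\<forall>r. regs s r < 2 ^ L) \<and> (\<forall>a. mem s a < 2 ^ L)"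

text \<open>The operations at most add up the bit lengths of their arguments, so a fixed expression
  stretches bit lengths by a constant factor. \<open>A \<ge> 1\<close> keeps both powers in the sum
  case at least 2.\<close>

lemma eval_bound:
  "\<exists>A\<ge>1. \<forall>L\<ge>1. \<forall>s. confined L s \<longrightarrow> eval e s < 2 ^ (A * L)"
proof (induction e)
  case (Const m)
  have "m < 2 ^ (Suc m * L)" if "L \<ge> 1" for L
  proof -
    have "m < 2 ^ m"
      by (rule less_exp)
    also have "\<dots> \<le> 2 ^ (Suc m * L)"
      by (rule power_increasing) (use that in \<open>auto simp: trans_le_add2 mult_le_mono2\<close>)
    finally show ?thesis .
  qed
  then show ?case
    by (intro exI[of _ "Suc m"]) auto
next
  case (Reg r)
  show ?case by (rule exI[of _ 1]) (auto simp: confined_def)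
next
  case (Mem e)
  show ?case by (rule exI[of _ 1]) (auto simp: confined_def)
next
  case (Plus e f)
  then obtain A B where AB: "A \<ge> 1" "B \<ge> 1"
    "\<And>L s. L \<ge> 1 \<Longrightarrow> confined L s \<Longrightarrow> eval e s < 2 ^ (A * L)"
    "\<And>L s. L \<ge> 1 \<Longrightarrow> confined L s \<Longrightarrow> eval f s < 2 ^ (B * L)"
    by metis
  have "eval e s + eval f s < 2 ^ ((A + B) * L)" if "L \<ge> 1" "confined L s" for L s
  proof -
    have "(2::nat) ^ 1 \<le> 2 ^ (A * L)" "(2::nat) ^ 1 \<le> 2 ^ (B * L)"
      by (rule power_increasing; use AB that in simp)+
    \<comment> \<open>Once the powers are written as 2 + c and 2 + d, their product exceeds their
      sum by c + d + c * d.\<close>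
    then obtain c d where "(2::nat) ^ (A * L) = 2 ^ 1 + c" "(2::nat) ^ (B * L) = 2 ^ 1 + d"
      unfolding le_iff_add by blast
    then have "(2::nat) ^ (A * L) + 2 ^ (B * L) \<le> 2 ^ (A * L) * 2 ^ (B * L)"
      by simp
    then show ?thesis
      using AB(3,4)[OF that] by (simp add: add_mult_distrib power_add)
  qed
  then show ?case
    using AB by (intro exI[of _ "A + B"]) auto
next
  case (Minus e f)
  then obtain A where A: "A \<ge> 1"
    "\<And>L s. L \<ge> 1 \<Longrightarrow> confined L s \<Longrightarrow> eval e s < 2 ^ (A * L)"
    by metis
  then show ?case
    by (intro exI[of _ A]) (auto intro: le_less_trans[OF diff_le_self])
next
  case (Times e f)
  then obtain A B where AB: "A \<ge> 1" "B \<ge> 1"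
    "\<And>L s. L \<ge> 1 \<Longrightarrow> confined L s \<Longrightarrow> eval e s < 2 ^ (A * L)"
    "\<And>L s. L \<ge> 1 \<Longrightarrow> confined L s \<Longrightarrow> eval f s < 2 ^ (B * L)"
    by metis
  then show ?case
    by (intro exI[of _ "A + B"]) (auto simp: add_mult_distrib power_add intro!: mult_strict_mono)
next
  case (Div e f)
  then obtain A where A: "A \<ge> 1"
    "\<And>L s. L \<ge> 1 \<Longrightarrow> confined L s \<Longrightarrow> eval e s < 2 ^ (A * L)"
    by metis
  then show ?case
    by (intro exI[of _ A]) (auto intro: le_less_trans[OF div_le_dividend])
qed

lemma len_eval_bound:
  "\<exists>A. \<forall>L\<ge>1. \<forall>s. confined L s \<longrightarrow> len (eval e s) \<le> A * L"
proof -
  obtain A where A: "\<And>L s. L \<ge> 1 \<Longrightarrow> confined L s \<Longrightarrow> eval e s < 2 ^ (A * L)"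
    using eval_bound by metis
  have "len (eval e s) \<le> Suc A * L" if "L \<ge> 1" "confined L s" for L s
    using len_le[OF A[OF that]] that by simp
  then show ?thesis by blast
qed

text \<open>The cost adds up the bit lengths of a fixed number of values and register names, each
  linear in \<open>L\<close>.\<close>

lemma cost_bound:
  "\<exists>K. \<forall>L\<ge>1. \<forall>s. confined L s \<longrightarrow> cost e s \<le> K * L"
proof (induction e)
  case (Const m)
  then show ?case by (auto intro: exI[of _ "len m"])
next
  case (Reg r)
  obtain A where "\<And>L s. L \<ge> 1 \<Longrightarrow> confined L s \<Longrightarrow> len (eval (Reg r) s) \<le> A * L"
    using len_eval_bound by metis
  then show ?case
    by (intro exI[of _ "len r + A"]) (auto simp: add_mult_distrib intro!: add_mono)
next
  case (Mem e)
  then obtain K where "\<And>L s. L \<ge> 1 \<Longrightarrow> confined L s \<Longrightarrow> cost e s \<le> K * L"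
    by metis
  moreover obtain A where "\<And>L s. L \<ge> 1 \<Longrightarrow> confined L s \<Longrightarrow> len (eval e s) \<le> A * L"
    using len_eval_bound by metis
  moreover obtain B where "\<And>L s. L \<ge> 1 \<Longrightarrow> confined L s \<Longrightarrow> len (eval (Mem e) s) \<le> B * L"
    using len_eval_bound by metis
  ultimately show ?case
    by (intro exI[of _ "K + A + B"]) (auto simp: add_mult_distrib intro!: add_mono)
next
  case (Plus e f)
  then obtain K K' where "\<And>L s. L \<ge> 1 \<Longrightarrow> confined L s \<Longrightarrow> cost e s \<le> K * L"
    "\<And>L s. L \<ge> 1 \<Longrightarrow> confined L s \<Longrightarrow> cost f s \<le> K' * L"
    by metis
  moreover obtain A B where "\<And>L s. L \<ge> 1 \<Longrightarrow> confined L s \<Longrightarrow> len (eval e s) \<le> A * L"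
      "\<And>L s. L \<ge> 1 \<Longrightarrow> confined L s \<Longrightarrow> len (eval f s) \<le> B * L"
    using len_eval_bound by metis
  ultimately show ?case
    by (intro exI[of _ "K + K' + A + B"]) (auto simp: add_mult_distrib intro!: add_mono)
next
  case (Minus e f)
  then obtain K K' where "\<And>L s. L \<ge> 1 \<Longrightarrow> confined L s \<Longrightarrow> cost e s \<le> K * L"
    "\<And>L s. L \<ge> 1 \<Longrightarrow> confined L s \<Longrightarrow> cost f s \<le> K' * L"
    by metis
  moreover obtain A B where "\<And>L s. L \<ge> 1 \<Longrightarrow> confined L s \<Longrightarrow> len (eval e s) \<le> A * L"
      "\<And>L s. L \<ge> 1 \<Longrightarrow> confined L s \<Longrightarrow> len (eval f s) \<le> B * L"
    using len_eval_bound by metis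
  ultimately show ?case
    by (intro exI[of _ "K + K' + A + B"]) (auto simp: add_mult_distrib intro!: add_mono)
next
  case (Times e f)
  then obtain K K' where "\<And>L s. L \<ge> 1 \<Longrightarrow> confined L s \<Longrightarrow> cost e s \<le> K * L"
    "\<And>L s. L \<ge> 1 \<Longrightarrow> confined L s \<Longrightarrow> cost f s \<le> K' * L"
    by metis
  moreover obtain A B where "\<And>L s. L \<ge> 1 \<Longrightarrow> confined L s \<Longrightarrow> len (eval e s) \<le> A * L"
      "\<And>L s. L \<ge> 1 \<Longrightarrow> confined L s \<Longrightarrow> len (eval f s) \<le> B * L"
    using len_eval_bound by metis
  ultimately show ?case
    by (intro exI[of _ "K + K' + A + B"]) (auto simp: add_mult_distrib intro!: add_mono)
next
  case (Div e f)
  then obtain K K' where "\<And>L s. L \<ge> 1 \<Longrightarrow> confined L s \<Longrightarrow> cost e s \<le> K * L"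
    "\<And>L s. L \<ge> 1 \<Longrightarrow> confined L s \<Longrightarrow> cost f s \<le> K' * L"
    by metis
  moreover obtain A B where "\<And>L s. L \<ge> 1 \<Longrightarrow> confined L s \<Longrightarrow> len (eval e s) \<le> A * L"
      "\<And>L s. L \<ge> 1 \<Longrightarrow> confined L s \<Longrightarrow> len (eval f s) \<le> B * L"
    using len_eval_bound by metis
  ultimately show ?case
    by (intro exI[of _ "K + K' + A + B"]) (auto simp: add_mult_distrib intro!: add_mono)
qed

text \<open>The length of the value is included because assignments and guards are charged for it on
  top of the cost.\<close>

definition cheap :: "nat \<Rightarrow> expr \<Rightarrow> bool" where
  "cheap K e \<longleftrightarrow> (\<forall>L\<ge>1. \<forall>s. confined L s \<longrightarrow> cost e s + len (eval e s) \<le> K * L)"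

lemma cheap_mono: "cheap K e \<Longrightarrow> K \<le> K' \<Longrightarrow> cheap K' e"
  unfolding cheap_def by (meson mult_le_mono1 order_trans)

lemma cheap_exists: "\<exists>K. cheap K e"
proof -
  obtain K where "\<And>L s. L \<ge> 1 \<Longrightarrow> confined L s \<Longrightarrow> cost e s \<le> K * L"
    using cost_bound by metis
  moreover obtain A where "\<And>L s. L \<ge> 1 \<Longrightarrow> confined L s \<Longrightarrow> len (eval e s) \<le> A * L"
    using len_eval_bound by metis
  ultimately show ?thesis
    unfolding cheap_def by (intro exI[of _ "K + A"]) (auto simp: add_mult_distrib intro!: add_mono)
qed

text \<open>
  In a state whose numbers have at most \<open>L\<close> bits, each single step of a program that is
  affordable for \<open>K\<close> takes time at most \<open>K * L\<close>.
\<close>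

primrec affordable :: "nat \<Rightarrow> prog \<Rightarrow> bool" where
  "affordable K Skip \<longleftrightarrow> 1 \<le> K"
| "affordable K (SetReg r e) \<longleftrightarrow> (\<exists>A. cheap A e \<and> A + len r \<le> K)"
| "affordable K (SetMem a e) \<longleftrightarrow> (\<exists>A B. cheap A a \<and> cheap B e \<and> A + B \<le> K)"
| "affordable K (Seq P Q) \<longleftrightarrow> affordable K P \<and> affordable K Q"
| "affordable K (Cond e P Q) \<longleftrightarrow> cheap K e \<and> affordable K P \<and> affordable K Q"
| "affordable K (While e P) \<longleftrightarrow> cheap K e \<and> affordable K P"

lemma affordable_mono: "affordable K P \<Longrightarrow> K \<le> K' \<Longrightarrow> affordable K' P"
  by (induction P) (auto intro: cheap_mono order_trans)

text \<open>A program contains finitely many expressions. The constant depends on the program alone,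
  which later keeps the exponent of the running time independent of the field, \<open>n\<close> and
  \<open>l\<close>.\<close>

lemma affordable_exists: "\<exists>K. affordable K P"
proof (induction P)
  case (SetReg r e)
  then show ?case using cheap_exists[of e] by auto
next
  case (SetMem a e)
  then show ?case using cheap_exists[of a] cheap_exists[of e] by auto
next
  case (Seq P Q)
  then show ?case
    by (metis affordable.simps(4) affordable_mono nle_le)
next
  case (Cond e P Q)
  then obtain K K' where "affordable K P" "affordable K' Q" by blast
  moreover obtain A where "cheap A e" using cheap_exists by blast
  ultimately show ?case
    by (intro exI[of _ "K + K' + A"]) (auto intro: affordable_mono cheap_mono)
next
  case (While e P)
  then obtain K where "affordable K P" by blast
  moreover obtain A where "cheap A e" using cheap_exists by blast
  ultimately show ?case
    by (intro exI[of _ "K + A"]) (auto intro: affordable_mono cheap_mono)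
qed auto

section \<open>Hoare rules with step counts\<close>

abbreviation conf :: "(nat \<Rightarrow> nat) \<Rightarrow> (nat \<Rightarrow> nat) \<Rightarrow> state" where
  "conf m R \<equiv> \<lparr>regs = R, mem = m\<rparr>"

text \<open>
  Total correctness confined \<open>T\<close> steps for programs that never write to the memory \<open>m\<close>, with all
  numbers confined to \<open>L\<close> bits.
\<close>

definition hoare ::
  "nat \<Rightarrow> (nat \<Rightarrow> nat) \<Rightarrow> nat \<Rightarrow> ((nat \<Rightarrow> nat) \<Rightarrow> bool) \<Rightarrow> prog \<Rightarrow> ((nat \<Rightarrow> nat) \<Rightarrow> bool) \<Rightarrow> bool"
  where
  "hoare L m T I P J \<longleftrightarrow>
     (\<forall>K R. 1 \<le> L \<longrightarrow> affordable K P \<longrightarrow> confined L (conf m R) \<longrightarrow> I R \<longrightarrow>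
        (\<exists>t R'. exec P (conf m R) t (conf m R') \<and> t \<le> T * (K * L) \<and>
                confined L (conf m R') \<and> J R'))"

lemma hoareD:
  assumes "hoare L m T I P J" "1 \<le> L" "affordable K P" "confined L (conf m R)" "I R"
  obtains t R' where "exec P (conf m R) t (conf m R')" "t \<le> T * (K * L)"
    "confined L (conf m R')" "J R'"
  using assms unfolding hoare_def by blast

lemma hoareI:
  assumes "\<And>K R. 1 \<le> L \<Longrightarrow> affordable K P \<Longrightarrow> confined L (conf m R) \<Longrightarrow> I R \<Longrightarrow>
    \<exists>t R'. exec P (conf m R) t (conf m R') \<and> t \<le> T * (K * L) \<and> confined L (conf m R') \<and> J R'"
  shows "hoare L m T I P J"
  using assms unfolding hoare_def by blast

text \<open>Closes each straight-line block: the other rules, applied backwards, synthesize a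
  precondition and a step count, which are compared here with the intended ones.\<close>

lemma hoare_pre:
  assumes "hoare L m T' I' P J"
    and "\<And>R. confined L (conf m R) \<Longrightarrow> I R \<Longrightarrow> I' R" "T' \<le> T"
  shows "hoare L m T I P J"
proof (rule hoareI)
  fix K R assume "1 \<le> L" "affordable K P" "confined L (conf m R)" "I R"
  with assms(1,2) obtain t R' where "exec P (conf m R) t (conf m R')" "t \<le> T' * (K * L)"
    "confined L (conf m R')" "J R'"
    by (meson hoareD)
  moreover from this(2) assms(3) have "t \<le> T * (K * L)"
    by (meson mult_le_mono1 order_trans)
  ultimately show "\<exists>t R'. exec P (conf m R) t (conf m R') \<and> t \<le> T * (K * L) \<and>
      confined L (conf m R') \<and> J R'"
    by blast
qed

lemma hoare_Skip: "hoare L m 1 J Skip J"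
proof (rule hoareI)
  fix K R assume "1 \<le> L" "affordable K Skip" "confined L (conf m R)" "J R"
  moreover from this have "1 \<le> K * L" by simp
  ultimately show "\<exists>t R'. exec Skip (conf m R) t (conf m R') \<and> t \<le> 1 * (K * L) \<and>
      confined L (conf m R') \<and> J R'"
    using exec.Skip[of "conf m R"] by (intro exI[of _ 1] exI[of _ R]) auto
qed

text \<open>The assignment axiom. The bound on the value belongs to the precondition, since the new
  state has to be confined to \<open>L\<close> bits again.\<close>

lemma hoare_SetReg:
  "hoare L m 1 (\<lambda>R. eval e (conf m R) < 2 ^ L \<and> J (R(r := eval e (conf m R)))) (SetReg r e) J"
proof (rule hoareI)
  fix K R
  assume *: "1 \<le> L" "affordable K (SetReg r e)" "confined L (conf m R)"
    "eval e (conf m R) < 2 ^ L \<and> J (R(r := eval e (conf m R)))"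
  let ?s = "conf m R"
  from *(2) obtain A where A: "cheap A e" "A + len r \<le> K" by auto
  have "cost e ?s + len (eval e ?s) \<le> A * L" "len r \<le> len r * L"
    using A(1) *(1,3) by (simp_all add: cheap_def)
  then have "cost e ?s + len r + len (eval e ?s) \<le> A * L + len r * L"
    by linarith
  also have "\<dots> \<le> 1 * (K * L)"
    using A(2) by (simp flip: add_mult_distrib)
  finally have "cost e ?s + len r + len (eval e ?s) \<le> 1 * (K * L)" .
  moreover have "exec (SetReg r e) ?s (cost e ?s + len r + len (eval e ?s))
      (conf m (R(r := eval e ?s)))"
    using exec.SetReg[of r e ?s] by simp
  ultimately show "\<exists>t R'. exec (SetReg r e) (conf m R) t (conf m R') \<and> t \<le> 1 * (K * L) \<and>
      confined L (conf m R') \<and> J R'"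
    using *(3,4) by (intro exI conjI) (auto simp: confined_def)
qed

text \<open>The premise for \<open>Q\<close> comes first so that backward application determines the
  intermediate assertion \<open>J\<close> from the postcondition.\<close>

lemma hoare_Seq:
  assumes "hoare L m U J Q I'" "hoare L m T I P J"
  shows "hoare L m (T + U) I (Seq P Q) I'"
proof (rule hoareI)
  fix K R assume *: "1 \<le> L" "affordable K (Seq P Q)" "confined L (conf m R)" "I R"
  then obtain t R' where 1: "exec P (conf m R) t (conf m R')" "t \<le> T * (K * L)"
    "confined L (conf m R')" "J R'"
    using hoareD[OF assms(2)] by (metis affordable.simps(4))
  with * obtain u R'' where 2: "exec Q (conf m R') u (conf m R'')" "u \<le> U * (K * L)"
    "confined L (conf m R'')" "I' R''"
    using hoareD[OF assms(1)] by (metis affordable.simps(4))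
  show "\<exists>t R'. exec (Seq P Q) (conf m R) t (conf m R') \<and> t \<le> (T + U) * (K * L) \<and>
      confined L (conf m R') \<and> I' R'"
    using exec.Seq[OF 1(1) 2(1)] 1 2 by (intro exI conjI) (auto simp: add_mult_distrib)
qed

text \<open>For simplicity the step count charges both branches instead of their maximum.\<close>

lemma hoare_Cond:
  assumes "hoare L m T I P J" "hoare L m U I' Q J"
  shows "hoare L m (1 + (T + U)) (\<lambda>R. if eval e (conf m R) \<noteq> 0 then I R else I' R) (Cond e P Q) J"
proof (rule hoareI)
  fix K R
  assume *: "1 \<le> L" "affordable K (Cond e P Q)" "confined L (conf m R)"
    "if eval e (conf m R) \<noteq> 0 then I R else I' R"
  then have c: "cost e (conf m R) + len (eval e (conf m R)) \<le> K * L"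
    by (auto simp: cheap_def)
  show "\<exists>t R'. exec (Cond e P Q) (conf m R) t (conf m R') \<and> t \<le> (1 + (T + U)) * (K * L) \<and>
      confined L (conf m R') \<and> J R'"
  proof (cases "eval e (conf m R) = 0")
    case True
    with * obtain t R' where "exec Q (conf m R) t (conf m R')" "t \<le> U * (K * L)"
      "confined L (conf m R')" "J R'"
      using hoareD[OF assms(2)] by (metis affordable.simps(5))
    then show ?thesis
      using c exec.CondFalse[OF True] by (intro exI conjI) (assumption | auto simp: add_mult_distrib)+
  next
    case False
    with * obtain t R' where "exec P (conf m R) t (conf m R')" "t \<le> T * (K * L)"
      "confined L (conf m R')" "J R'"
      using hoareD[OF assms(1)] by (metis affordable.simps(5))
    then show ?thesis
      using c exec.CondTrue[OF False] by (intro exI conjI) (assumption | auto simp: add_mult_distrib)+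
  qed
qed

lemma hoare_For:
  assumes body: "\<And>j. j < N \<Longrightarrow> hoare L m T (I j) P (I (Suc j))"
    and guard: "\<And>j R. j \<le> N \<Longrightarrow> I j R \<Longrightarrow> eval e (conf m R) \<noteq> 0 \<longleftrightarrow> j < N"
  shows "hoare L m (N * (T + 1) + 1) (I 0) (While e P) (I N)"
proof -
  have "hoare L m ((N - j) * (T + 1) + 1) (I j) (While e P) (I N)" if "j \<le> N" for j
    using that
  proof (induction j rule: inc_induct)
    case base
    show ?case
    proof (rule hoareI)
      fix K R assume *: "1 \<le> L" "affordable K (While e P)" "confined L (conf m R)" "I N R"
      from *(4) have e: "eval e (conf m R) = 0" using guard by blast
      have "cost e (conf m R) + len (eval e (conf m R)) \<le> K * L"
        using * by (auto simp: cheap_def)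
      then show "\<exists>t R'. exec (While e P) (conf m R) t (conf m R') \<and>
          t \<le> ((N - N) * (T + 1) + 1) * (K * L) \<and> confined L (conf m R') \<and> I N R'"
        using exec.WhileFalse[OF e] *(3,4) by (intro exI conjI) (assumption | simp)+
    qed
  next
    case (step j)
    show ?case
    proof (rule hoareI)
      fix K R assume *: "1 \<le> L" "affordable K (While e P)" "confined L (conf m R)" "I j R"
      from *(4) have e: "eval e (conf m R) \<noteq> 0" using guard step by (meson less_imp_le)
      have c: "cost e (conf m R) + len (eval e (conf m R)) \<le> K * L"
        using * by (auto simp: cheap_def)
      obtain t R' where 1: "exec P (conf m R) t (conf m R')" "t \<le> T * (K * L)"
        "confined L (conf m R')" "I (Suc j) R'"
        using * hoareD[OF body[OF step(2)]] by (metis affordable.simps(6))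
      obtain u R'' where 2: "exec (While e P) (conf m R') u (conf m R'')"
        "u \<le> ((N - Suc j) * (T + 1) + 1) * (K * L)" "confined L (conf m R'')" "I N R''"
        using 1 * hoareD[OF step(3)] by metis
      have "N - j = Suc (N - Suc j)" using step by simp
      then have "(cost e (conf m R) + len (eval e (conf m R)) + t + u)
          \<le> ((N - j) * (T + 1) + 1) * (K * L)"
        using c 1(2) 2(2) by (simp add: algebra_simps)
      then show "\<exists>t R'. exec (While e P) (conf m R) t (conf m R') \<and>
          t \<le> ((N - j) * (T + 1) + 1) * (K * L) \<and> confined L (conf m R') \<and> I N R'"
        using exec.WhileTrue[OF e 1(1) 2(1)] 2 by blast
    qed
  qed
  from this[of 0] show ?thesis by simp
qed

section \<open>The refutation algorithm\<close>

lemma radix_less: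
  fixes Y d q m :: nat
  assumes "Y < m" "d < q"
  shows "Y * q + d < m * q"
proof -
  have "Y * q + d < Suc Y * q" using assms(2) by simp
  also have "\<dots> \<le> m * q" using assms(1) by (intro mult_le_mono1) simp
  finally show ?thesis .
qed

text \<open>Horner's scheme: the lowest digit is appended last, so the induction shifts the sequence
  of digits by one.\<close>

lemma digits_exist:
  fixes d :: "nat \<Rightarrow> nat"
  assumes "\<And>j. j < m \<Longrightarrow> d j < q"
  shows "\<exists>Y<q ^ m. \<forall>j<m. Y div q ^ j mod q = d j"
  using assms
proof (induction m arbitrary: d)
  case 0
  then show ?case by simp
next
  case (Suc m)
  have "\<exists>Y<q ^ m. \<forall>j<m. Y div q ^ j mod q = d (Suc j)"
    by (rule Suc.IH) (use Suc.prems in simp)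
  then obtain Y where Y: "Y < q ^ m" "\<And>j. j < m \<Longrightarrow> Y div q ^ j mod q = d (Suc j)"
    by auto
  have d: "d 0 < q" using Suc.prems by blast
  have "Y * q + d 0 < q ^ m * q"
    using Y(1) d by (rule radix_less)
  moreover have "(Y * q + d 0) div q ^ j mod q = d j" if "j < Suc m" for j
    using that d Y(2) by (cases j) (simp_all add: div_mult2_eq)
  ultimately show ?case
    by (intro exI[of _ "Y * q + d 0"]) (simp add: mult.commute)
qed

text \<open>
  The variables are cut into \<open>M\<close> blocks of \<open>B\<close> consecutive variables. Equations whose nonzero
  coefficients lie in the same sequence of blocks form a class. An assignment to the \<open>k * B \<le> l\<close>
  variables of such a sequence is a number with as many digits in base \<open>q\<close>, in which blocks that
  occur several times in the sequence may receive different values each time.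
\<close>

locale block_refutation =
  fixes F :: "nat ring" (structure) and n l k :: nat
  assumes finite_field: "finite_field F"
    and k_pos: "0 < k" and k_le_l: "k \<le> l" and l_le_n: "2 * l \<le> n"
begin

section \<open>Blocks, classes and the optimum of a class\<close>

definition q :: nat where "q = field_size F"
definition B :: nat where "B = l div k"
text \<open>The extra 1 covers a last block that may be incomplete.\<close>

definition M :: nat where "M = n div B + 1"

sublocale field F
  using finite_field by (simp add: finite_field_def)

lemma carrier_eq: "carrier F = {..<q}"
proof -
  obtain c where "carrier F = {..<c}"
    using finite_field finite_field_def by blast
  then show ?thesis unfolding q_def by simp
qed

lemma q_ge_2: "2 \<le> q"
proof -
  have "\<zero> < q" "\<one> < q"
    using zero_closed one_closed unfolding carrier_eq by simp_all
  moreover have "\<zero> \<noteq> \<one>"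
    by simp
  ultimately show ?thesis by linarith
qed

lemma zero_in_carrier: "0 \<in> carrier F"
  using q_ge_2 by (simp add: carrier_eq)

lemma B_pos: "0 < B"
  using k_pos k_le_l by (simp add: B_def div_greater_zero_iff)

lemma kB_le_l: "k * B \<le> l"
  by (simp add: B_def mult.commute)

lemma M_pos: "0 < M"
  by (simp add: M_def)

lemma block_less_M: "i < n \<Longrightarrow> i div B < M"
  unfolding M_def by (simp add: div_le_mono less_Suc_eq_le)

text \<open>Recursive, like \<open>code\<close> and \<open>lhs\<close>, to match the machine's
  single pass over the coefficients of an equation.\<close>

primrec rank :: "(nat \<Rightarrow> nat) \<Rightarrow> nat \<Rightarrow> nat" where
  "rank v 0 = 0"
| "rank v (Suc i) = (if v i = \<zero> then rank v i else Suc (rank v i))"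

text \<open>The base \<open>M\<close> number whose digits are the blocks of the nonzero
  coefficients, the leftmost one being the most significant. It identifies the class of
  \<open>v\<close>.\<close>

primrec code :: "(nat \<Rightarrow> nat) \<Rightarrow> nat \<Rightarrow> nat" where
  "code v 0 = 0"
| "code v (Suc i) = (if v i = \<zero> then code v i else code v i * M + i div B)"

text \<open>
  The partial sum starts with the element number 0 instead of the zero of the field, which spares
  the machine from having to look for the latter.
\<close>

primrec lhs :: "(nat \<Rightarrow> nat) \<Rightarrow> nat \<Rightarrow> nat \<Rightarrow> nat" where
  "lhs v Y 0 = 0"
| "lhs v Y (Suc i) = (if v i = \<zero> then lhs v Y i
     else lhs v Y i \<oplus> v i \<otimes> (Y div (q ^ B) ^ rank v i div q ^ (i mod B) mod q))"

text \<open>Both sides of the equation are shifted by the element numbered 0, as \<open>lhs\<close>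
  starts from it; the shift cancels.\<close>

definition agrees :: "((nat \<Rightarrow> nat) \<Rightarrow> nat) \<Rightarrow> nat \<Rightarrow> nat \<Rightarrow> (nat \<Rightarrow> nat) \<Rightarrow> bool" where
  "agrees b N Y v \<longleftrightarrow> code v n = N \<and> lhs v Y n = 0 \<oplus> b v"

text \<open>The limit \<open>y\<close> is a parameter so that partial maxima can serve as loop
  invariants; the inserted 0 is their initial value.\<close>

definition best :: "(nat \<Rightarrow> nat) set \<Rightarrow> ((nat \<Rightarrow> nat) \<Rightarrow> nat) \<Rightarrow> nat \<Rightarrow> nat \<Rightarrow> nat" where
  "best H b N y = Max (insert 0 ((\<lambda>Y. card {v \<in> H. agrees b N Y v}) ` {..<y}))"

definition alg_val :: "LIN \<Rightarrow> real" where
  "alg_val = (\<lambda>(H, b). real (\<Sum>N<M ^ k. best H b N ((q ^ B) ^ k)) / real (card H))"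

lemma rank_eq_card: "rank v i = card {j \<in> {..<i}. v j \<noteq> \<zero>}"
proof (induction i)
  case (Suc i)
  have "{j \<in> {..<Suc i}. v j \<noteq> \<zero>} =
    (if v i = \<zero> then {j \<in> {..<i}. v j \<noteq> \<zero>} else insert i {j \<in> {..<i}. v j \<noteq> \<zero>})"
    by (auto simp: less_Suc_eq)
  with Suc show ?case by simp
qed simp

lemma rank_n: "v \<in> sparse_vectors F n k \<Longrightarrow> rank v n = k"
  by (simp add: rank_eq_card sparse_vectors_def)

lemma rank_mono: "i \<le> j \<Longrightarrow> rank v i \<le> rank v j"
  unfolding rank_eq_card by (rule card_mono) auto

lemma rank_less_k:
  assumes "v \<in> sparse_vectors F n k" "i < n" "v i \<noteq> \<zero>"
  shows "rank v i < k"
  using rank_mono[of "Suc i" n v] rank_n[OF assms(1)] assms(2,3) by simp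

lemma code_less:
  assumes "i \<le> n"
  shows "code v i < M ^ rank v i"
  using assms
proof (induction i)
  case (Suc i)
  then have "code v i < M ^ rank v i" "i div B < M"
    by (auto intro: block_less_M)
  then have "code v i * M + i div B < M ^ rank v i * M"
    by (rule radix_less)
  with Suc show ?case by (simp add: mult.commute)
qed simp

text \<open>Digits are appended at the low end, so division strips those contributed by positions
  from \<open>i\<close> on.\<close>

lemma code_div:
  assumes "i \<le> j" "j \<le> n"
  shows "code v j div M ^ (rank v j - rank v i) = code v i"
  using assms
proof (induction j rule: dec_induct)
  case (step j)
  show ?case
  proof (cases "v j = \<zero>")
    case False
    have "rank v i \<le> rank v j" using step by (intro rank_mono) simp
    then have "rank v (Suc j) - rank v i = Suc (rank v j - rank v i)"
      using False by simp
    moreover have "j div B < M" using step by (intro block_less_M) simp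
    ultimately show ?thesis
      using False step by (simp add: div_mult2_eq)
  qed (use step in simp)
qed simp

text \<open>The coefficient of rank r supplies the digit number r counted from the top of
  \<open>k\<close> digits. Hence the class alone determines in which block each nonzero coefficient
  lies.\<close>

lemma block_of_code:
  assumes "v \<in> sparse_vectors F n k" "i < n" "v i \<noteq> \<zero>"
  shows "code v n div M ^ (k - 1 - rank v i) mod M = i div B"
proof -
  have "code v n div M ^ (rank v n - rank v (Suc i)) = code v (Suc i)"
    using assms(2) by (intro code_div) auto
  moreover have "i div B < M" using assms(2) by (rule block_less_M)
  ultimately show ?thesis
    using assms(3) by (simp add: rank_n[OF assms(1)])
qed

lemma sparse_closed:
  assumes "v \<in> sparse_vectors F n k" "i < n"
  shows "v i \<in> carrier F"
  using assms by (auto simp: sparse_vectors_def vectors_def PiE_def Pi_def)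

lemma lhs_closed:
  assumes "v \<in> sparse_vectors F n k" "i \<le> n"
  shows "lhs v Y i \<in> carrier F"
  using assms(2)
proof (induction i)
  case 0
  then show ?case by (simp add: zero_in_carrier)
next
  case (Suc i)
  moreover have "x mod q \<in> carrier F" for x
    using q_ge_2 by (simp add: carrier_eq)
  ultimately show ?case
    using sparse_closed[OF assms(1), of i] by simp
qed

text \<open>The coefficient at \<open>i\<close> reads the digit at offset \<open>i mod B\<close> of
  slot \<open>rank v i\<close>. If these digits spell out \<open>x\<close>, the pass computes the
  true sum, shifted by the element numbered 0.\<close>

lemma lhs_eq_finsum:
  assumes v: "v \<in> sparse_vectors F n k" and x: "x \<in> vectors F n"
    and Y: "\<And>i. i < n \<Longrightarrow> v i \<noteq> \<zero> \<Longrightarrow> Y div q ^ (rank v i * B + i mod B) mod q = x i"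
  shows "lhs v Y n = 0 \<oplus> (\<Oplus>i\<in>{..<n}. v i \<otimes> x i)"
proof -
  have xc: "x i \<in> carrier F" if "i < n" for i
    using x that by (auto simp: vectors_def PiE_def Pi_def)
  have "lhs v Y i = 0 \<oplus> (\<Oplus>j\<in>{..<i}. v j \<otimes> x j)" if "i \<le> n" for i
    using that
  proof (induction i)
    case 0
    then show ?case by (simp add: zero_in_carrier)
  next
    case (Suc i)
    have c: "v j \<otimes> x j \<in> carrier F" if "j < Suc i" for j
      using that Suc.prems xc sparse_closed[OF v] by simp
    then have s: "(\<Oplus>j\<in>{..<i}. v j \<otimes> x j) \<in> carrier F"
      by (intro finsum_closed) auto
    have "(\<Oplus>j\<in>{..<Suc i}. v j \<otimes> x j) = v i \<otimes> x i \<oplus> (\<Oplus>j\<in>{..<i}. v j \<otimes> x j)"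
      unfolding lessThan_Suc by (subst finsum_insert) (use c in auto)
    also have "0 \<oplus> \<dots> = (0 \<oplus> (\<Oplus>j\<in>{..<i}. v j \<otimes> x j)) \<oplus> v i \<otimes> x i"
      using c s zero_in_carrier by (simp add: a_ac)
    finally have e: "0 \<oplus> (\<Oplus>j\<in>{..<Suc i}. v j \<otimes> x j) =
      (0 \<oplus> (\<Oplus>j\<in>{..<i}. v j \<otimes> x j)) \<oplus> v i \<otimes> x i" .
    show ?case
    proof (cases "v i = \<zero>")
      case True
      with Suc e s xc zero_in_carrier show ?thesis by simp
    next
      case False
      have "Y div (q ^ B) ^ rank v i div q ^ (i mod B) mod q = x i"
        using Y[of i] False Suc.prems
        by (simp add: power_add power_mult div_mult2_eq mult.commute[of _ B])
      with Suc e False show ?thesis by simp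
    qed
  qed
  then show ?thesis by simp
qed

text \<open>As \<open>N\<close> fixes the block that each slot stands for, one \<open>Y\<close>
  obtained by copying the values of \<open>x\<close> into all slots serves every equation of the
  class.\<close>

lemma assignment_digits_exist:
  assumes x: "x \<in> vectors F n"
  shows "\<exists>Y<(q ^ B) ^ k. \<forall>v \<in> sparse_vectors F n k. code v n = N \<longrightarrow>
    lhs v Y n = 0 \<oplus> (\<Oplus>i\<in>{..<n}. v i \<otimes> x i)"
proof -
  \<comment> \<open>The variable to which digit \<open>j\<close> belongs: slot
    \<open>j div B\<close> stands for a block read off from \<open>N\<close>, and
    \<open>j mod B\<close> is the offset in that block.\<close>
  define pos where "pos j = (N div M ^ (k - 1 - j div B) mod M) * B + j mod B" for j
  \<comment> \<open>The last block may reach beyond the variables; there 0 serves as a valid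
    digit.\<close>
  define d where "d j = (if pos j < n then x (pos j) else 0)" for j
  have "x i < q" if "i < n" for i
    using x that by (auto simp: vectors_def PiE_def Pi_def carrier_eq)
  then have "d j < q" for j
    using q_ge_2 by (simp add: d_def)
  then obtain Y where Y: "Y < q ^ (k * B)" "\<And>j. j < k * B \<Longrightarrow> Y div q ^ j mod q = d j"
    using digits_exist[of "k * B" d q] by auto
  have "lhs v Y n = 0 \<oplus> (\<Oplus>i\<in>{..<n}. v i \<otimes> x i)"
    if v: "v \<in> sparse_vectors F n k" "code v n = N" for v
  proof (rule lhs_eq_finsum[OF v(1) x])
    fix i assume i: "i < n" "v i \<noteq> \<zero>"
    let ?j = "rank v i * B + i mod B"
    have "rank v i < k" using rank_less_k[OF v(1) i] .
    then have "?j < k * B"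
      using B_pos by (intro radix_less) auto
    moreover have "pos ?j = i"
      using block_of_code[OF v(1) i] B_pos v(2) div_mult_mod_eq[of i B] by (simp add: pos_def)
    ultimately show "Y div q ^ ?j mod q = x i"
      using Y(2) i by (simp add: d_def)
  qed
  moreover have "q ^ (k * B) = (q ^ B) ^ k"
    by (simp add: mult.commute flip: power_mult)
  ultimately show ?thesis using Y(1) by metis
qed

section \<open>The computed value lies between the true value and 1\<close>

lemma finite_vectors: "finite (vectors F n)"
  unfolding vectors_def carrier_eq by (intro finite_PiE) auto

lemma finite_sparse: "finite (sparse_vectors F n k)"
  unfolding sparse_vectors_def using finite_vectors by simp

lemma vectors_nonempty: "vectors F n \<noteq> {}"
  unfolding vectors_def using zero_in_carrier by (auto simp: PiE_eq_empty_iff)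

lemma code_n_less: "v \<in> sparse_vectors F n k \<Longrightarrow> code v n < M ^ k"
  using code_less[of n v] by (simp add: rank_n)

text \<open>The codes of sparse vectors are below \<open>M ^ k\<close> and partition
  \<open>H\<close>. The predicate is arbitrary in order to count satisfied equations as well as
  whole classes.\<close>

lemma card_classes:
  assumes "H \<subseteq> sparse_vectors F n k"
  shows "card {v \<in> H. P v} = (\<Sum>N<M ^ k. card {v \<in> H. code v n = N \<and> P v})"
proof -
  have fin: "finite H" using assms finite_sparse finite_subset by blast
  have "{v \<in> H. P v} = (\<Union>N<M ^ k. {v \<in> H. code v n = N \<and> P v})"
    using assms code_n_less by auto
  also have "card \<dots> = (\<Sum>N<M ^ k. card {v \<in> H. code v n = N \<and> P v})"
    using fin by (intro card_UN_disjoint) auto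
  finally show ?thesis .
qed

lemma best_ge: "Y < y \<Longrightarrow> card {v \<in> H. agrees b N Y v} \<le> best H b N y"
  unfolding best_def by (intro Max_ge) auto

lemma best_le:
  assumes "\<And>Y. Y < y \<Longrightarrow> card {v \<in> H. agrees b N Y v} \<le> t"
  shows "best H b N y \<le> t"
  using assms unfolding best_def by (intro Max.boundedI) auto

lemma best_Suc: "best H b N (Suc y) = max (best H b N y) (card {v \<in> H. agrees b N y v})"
proof -
  have "insert 0 ((\<lambda>Y. card {v \<in> H. agrees b N Y v}) ` {..<Suc y}) =
    insert (card {v \<in> H. agrees b N y v}) (insert 0 ((\<lambda>Y. card {v \<in> H. agrees b N Y v}) ` {..<y}))"
    by (auto simp: lessThan_Suc)
  then show ?thesis
    unfolding best_def by (subst max.commute) (simp only:, subst Max_insert, auto)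
qed

text \<open>A global assignment induces an assignment to the slots of each class, where the optimum
  is at least as good.\<close>

lemma satisfied_le_best:
  assumes "H \<subseteq> sparse_vectors F n k" "x \<in> vectors F n"
  shows "card {v \<in> H. (\<Oplus>i\<in>{..<n}. v i \<otimes> x i) = b v} \<le> (\<Sum>N<M ^ k. best H b N ((q ^ B) ^ k))"
proof (subst card_classes[OF assms(1)], rule sum_mono)
  fix N
  obtain Y where Y: "Y < (q ^ B) ^ k" "\<And>v. v \<in> sparse_vectors F n k \<Longrightarrow> code v n = N \<Longrightarrow>
      lhs v Y n = 0 \<oplus> (\<Oplus>i\<in>{..<n}. v i \<otimes> x i)"
    using assignment_digits_exist[OF assms(2), of N] by auto
  have "finite H" using assms finite_sparse finite_subset by blast
  then have "card {v \<in> H. code v n = N \<and> (\<Oplus>i\<in>{..<n}. v i \<otimes> x i) = b v}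
      \<le> card {v \<in> H. agrees b N Y v}"
    using assms(1) Y(2) by (intro card_mono) (auto simp: agrees_def)
  also have "\<dots> \<le> best H b N ((q ^ B) ^ k)"
    by (rule best_ge[OF Y(1)])
  finally show "card {v \<in> H. code v n = N \<and> (\<Oplus>i\<in>{..<n}. v i \<otimes> x i) = b v} \<le> \<dots>" .
qed

lemma LIN_val_le_alg_val:
  assumes "(H, b) \<in> LIN_instances F n k"
  shows "LIN_val F n (H, b) \<le> alg_val (H, b)"
proof -
  have H: "H \<subseteq> sparse_vectors F n k" using assms by (auto simp: LIN_instances_def)
  then have fin: "finite H" using finite_sparse finite_subset by blast
  have "1 / real (card H) * (\<Sum>v\<in>H. of_bool ((\<Oplus>i\<in>{..<n}. v i \<otimes> x i) = b v)) \<le> alg_val (H, b)"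
    if "x \<in> vectors F n" for x
  proof -
    have "(\<Sum>v\<in>H. of_bool ((\<Oplus>i\<in>{..<n}. v i \<otimes> x i) = b v)) =
      real (card {v \<in> H. (\<Oplus>i\<in>{..<n}. v i \<otimes> x i) = b v})"
      using fin by (simp add: Int_def)
    also have "\<dots> \<le> real (\<Sum>N<M ^ k. best H b N ((q ^ B) ^ k))"
      using satisfied_le_best[OF H that] by (simp only: of_nat_le_iff)
    finally show ?thesis
      by (simp add: alg_val_def divide_right_mono)
  qed
  then show ?thesis
    unfolding LIN_val_def using finite_vectors vectors_nonempty by simp
qed

lemma alg_val_nonneg: "0 \<le> alg_val I"
  by (auto simp: alg_val_def split_beta intro!: divide_nonneg_nonneg sum_nonneg)

lemma best_le_card_class:
  assumes "finite H"
  shows "best H b N y \<le> card {v \<in> H. code v n = N}"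
  using assms by (intro best_le card_mono) (auto simp: agrees_def)

text \<open>No class contributes more than its size. Besides \<open>alg_val_le_1\<close>, this gives
  the bound on the machine's running total.\<close>

lemma sum_best_le_card:
  assumes "H \<subseteq> sparse_vectors F n k"
  shows "(\<Sum>N<M ^ k. best H b N y) \<le> card H"
proof -
  have fin: "finite H" using assms finite_sparse finite_subset by blast
  have "(\<Sum>N<M ^ k. best H b N y) \<le> (\<Sum>N<M ^ k. card {v \<in> H. code v n = N})"
    by (intro sum_mono best_le_card_class fin)
  also have "\<dots> = card H"
    using card_classes[OF assms, of "\<lambda>_. True"] by simp
  finally show ?thesis .
qed

lemma alg_val_le_1:
  assumes "(H, b) \<in> LIN_instances F n k"
  shows "alg_val (H, b) \<le> 1"
proof -
  have "H \<subseteq> sparse_vectors F n k" using assms by (auto simp: LIN_instances_def)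
  then have "(\<Sum>N<M ^ k. best H b N ((q ^ B) ^ k)) \<le> card H" by (rule sum_best_le_card)
  then show ?thesis
    unfolding alg_val_def prod.case by (intro divide_le_eq_1[THEN iffD2]) (auto simp del: of_nat_sum)
qed

end

section \<open>Semirandom and random instances\<close>

text \<open>The Cauchy-Schwarz inequality against the all-ones vector.\<close>

lemma sum_sqrt_le:
  fixes h :: "'a \<Rightarrow> real"
  assumes "\<And>i. i \<in> A \<Longrightarrow> 0 \<le> h i"
  shows "(\<Sum>i\<in>A. sqrt (h i)) \<le> sqrt (card A * (\<Sum>i\<in>A. h i))"
proof (rule real_le_rsqrt)
  have "(\<Sum>i\<in>A. sqrt (h i))\<^sup>2 \<le> card A * (\<Sum>i\<in>A. (sqrt (h i))\<^sup>2)"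
    using sum_squared_le_sum_of_squares[of "\<lambda>i. sqrt (h i)" A] by (simp add: mult.commute)
  also have "(\<Sum>i\<in>A. (sqrt (h i))\<^sup>2) = (\<Sum>i\<in>A. h i)"
    using assms by (intro sum.cong) auto
  finally show "(\<Sum>i\<in>A. sqrt (h i))\<^sup>2 \<le> card A * (\<Sum>i\<in>A. h i)" .
qed

text \<open>The probability under a mixture is the average over its components. This passes from
  semirandom to random instances.\<close>

lemma prob_bind_pmf_ge:
  assumes "\<And>x. x \<in> set_pmf p \<Longrightarrow> c \<le> measure_pmf.prob (f x) A" "0 \<le> c"
  shows "c \<le> measure_pmf.prob (bind_pmf p f) A"
proof -
  have "ennreal c = (\<integral>\<^sup>+x. ennreal c \<partial>measure_pmf p)" by simp
  also have "\<dots> \<le> (\<integral>\<^sup>+x. emeasure (measure_pmf (f x)) A \<partial>measure_pmf p)"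
    using assms(1)
    by (intro nn_integral_mono_AE AE_pmfI) (auto simp: measure_pmf.emeasure_eq_measure intro: ennreal_leI)
  also have "\<dots> = ennreal (measure_pmf.prob (bind_pmf p f) A)"
    by (simp flip: measure_pmf.emeasure_eq_measure)
  finally show ?thesis by (simp add: ennreal_le_iff)
qed

context block_refutation
begin

section \<open>Concentration over random right-hand sides\<close>

lemma finite_carrier: "finite (carrier F)"
  by (simp add: carrier_eq)

text \<open>Shifting by the element numbered 0 is a bijection. Hence a uniform right-hand side
  satisfies an equation with probability \<open>1 / q\<close>.\<close>

lemma card_solutions:
  assumes "c \<in> carrier F"
  shows "card {y \<in> carrier F. c = 0 \<oplus> y} = 1"
proof -
  have "{y \<in> carrier F. c = 0 \<oplus> y} = {\<ominus> 0 \<oplus> c}"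
  proof (intro equalityI subsetI)
    fix y assume "y \<in> {y \<in> carrier F. c = 0 \<oplus> y}"
    then show "y \<in> {\<ominus> 0 \<oplus> c}"
      using zero_in_carrier by (simp add: r_neg1)
  next
    fix y assume "y \<in> {\<ominus> 0 \<oplus> c}"
    then show "y \<in> {y \<in> carrier F. c = 0 \<oplus> y}"
      using assms zero_in_carrier by (simp add: r_neg2)
  qed
  then show ?thesis by simp
qed

abbreviation rhs_pmf :: "(nat \<Rightarrow> nat) set \<Rightarrow> ((nat \<Rightarrow> nat) \<Rightarrow> nat) pmf" where
  "rhs_pmf H \<equiv> Pi_pmf H undefined (\<lambda>_. pmf_of_set (carrier F))"

text \<open>Hoeffding's inequality for the indicators of satisfied equations. The left-hand values
  \<open>g\<close> are fixed before the right-hand sides are drawn.\<close>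

lemma rhs_tail:
  assumes H: "finite H" "S \<subseteq> H" "S \<noteq> {}" and g: "\<And>v. v \<in> S \<Longrightarrow> g v \<in> carrier F" and t: "0 \<le> t"
  shows "measure_pmf.prob (rhs_pmf H) {b. real (card S) / real q + t \<le> real (card {v \<in> S. g v = 0 \<oplus> b v})}
    \<le> exp (- 2 * t\<^sup>2 / real (card S))"
proof -
  have fin: "finite S" using H finite_subset by blast
  define X :: "(nat \<Rightarrow> nat) \<Rightarrow> ((nat \<Rightarrow> nat) \<Rightarrow> nat) \<Rightarrow> real"
    where "X v b = of_bool (g v = 0 \<oplus> b v)" for v b
  interpret Hoeffding_ineq "measure_pmf (rhs_pmf H)" S X "\<lambda>_. 0" "\<lambda>_. 1"
    "\<Sum>v\<in>S. measure_pmf.expectation (rhs_pmf H) (X v)"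
  proof unfold_locales
    \<comment> \<open>Each indicator depends on its own coordinate of \<open>b\<close> only, and the
      coordinates are independent.\<close>
    show "prob_space.indep_vars (measure_pmf (rhs_pmf H)) (\<lambda>_. borel) X S"
      unfolding X_def
      by (rule prob_space.indep_vars_compose2[OF measure_pmf.prob_space_axioms, where X = "\<lambda>v f. f v" and M' = "\<lambda>_. count_space UNIV"
            and Y = "\<lambda>v y. of_bool (g v = 0 \<oplus> y)"])
        (use prob_space.indep_vars_subset[OF measure_pmf.prob_space_axioms indep_vars_Pi_pmf[OF H(1)] H(2)] in auto)
  qed (auto simp: fin X_def)
  have "measure_pmf.expectation (rhs_pmf H) (X v) = 1 / real q" if v: "v \<in> S" for v
  proof -
    have "measure_pmf.expectation (rhs_pmf H) (X v) =
      measure_pmf.expectation (map_pmf (\<lambda>b. b v) (rhs_pmf H)) (\<lambda>y. of_bool (g v = 0 \<oplus> y))"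
      by (simp add: X_def[abs_def])
    also have "map_pmf (\<lambda>b. b v) (rhs_pmf H) = pmf_of_set (carrier F)"
      using v H by (subst Pi_pmf_component) auto
    also have "measure_pmf.expectation \<dots> (\<lambda>y. of_bool (g v = 0 \<oplus> y)) =
        (\<Sum>y\<in>carrier F. of_bool (g v = 0 \<oplus> y)) / real q"
      using zero_in_carrier finite_carrier by (subst integral_pmf_of_set) (auto simp: q_def)
    also have "(\<Sum>y\<in>carrier F. of_bool (g v = 0 \<oplus> y)) = real (card {y \<in> carrier F. g v = 0 \<oplus> y})"
      using finite_carrier by (simp add: Int_def)
    also have "\<dots> = 1" using card_solutions[OF g[OF v]] by simp
    finally show ?thesis .
  qed
  then have "(\<Sum>v\<in>S. measure_pmf.expectation (rhs_pmf H) (X v)) = real (card S) / real q"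
    by simp
  moreover have "(\<Sum>v\<in>S. X v b) = real (card {v \<in> S. g v = 0 \<oplus> b v})" for b
    using fin by (simp add: X_def Int_def)
  moreover have "card S > 0" using fin H(3) by (simp add: card_gt_0_iff)
  ultimately show ?thesis
    using Hoeffding_ineq_ge[OF t] by simp
qed

section \<open>Deviations within classes and the union bound over them\<close>

definition class_size :: "(nat \<Rightarrow> nat) set \<Rightarrow> nat \<Rightarrow> nat" where
  "class_size H N = card {v \<in> H. code v n = N}"

lemma sum_class_size: "H \<subseteq> sparse_vectors F n k \<Longrightarrow> (\<Sum>N<M ^ k. class_size H N) = card H"
  using card_classes[of H "\<lambda>_. True"] by (simp add: class_size_def)

text \<open>The deviation scales with the square root of the class size, which makes the tail bound
  the same for all classes.\<close>

definition exceeds :: "(nat \<Rightarrow> nat) set \<Rightarrow> real \<Rightarrow> nat \<Rightarrow> nat \<Rightarrow> ((nat \<Rightarrow> nat) \<Rightarrow> nat) set" where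
  "exceeds H t N Y = {b. real (class_size H N) / real q + sqrt (real (class_size H N) * t)
     < real (card {v \<in> H. agrees b N Y v})}"

lemma prob_exceeds:
  assumes H: "H \<subseteq> sparse_vectors F n k" and t: "0 \<le> t"
  shows "measure_pmf.prob (rhs_pmf H) (exceeds H t N Y) \<le> exp (- 2 * t)"
proof -
  define S where "S = {v \<in> H. code v n = N}"
  have fin: "finite H" using H finite_sparse finite_subset by blast
  have agr: "{v \<in> H. agrees b N Y v} = {v \<in> S. lhs v Y n = 0 \<oplus> b v}" for b
    by (auto simp: S_def agrees_def)
  show ?thesis
  proof (cases "S = {}")
    \<comment> \<open>For an empty class the strict inequality reads 0 < 0.\<close>
    case True
    then have "exceeds H t N Y = {}"
      unfolding exceeds_def agr class_size_def S_def[symmetric] by simp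
    then show ?thesis by simp
  next
    case False
    then have pos: "card S > 0" using fin by (simp add: S_def card_gt_0_iff)
    have "measure_pmf.prob (rhs_pmf H) (exceeds H t N Y) \<le> measure_pmf.prob (rhs_pmf H)
      {b. real (card S) / real q + sqrt (real (card S) * t) \<le> real (card {v \<in> S. lhs v Y n = 0 \<oplus> b v})}"
      by (intro measure_pmf.finite_measure_mono)
        (auto simp: exceeds_def agr class_size_def S_def[symmetric])
    also have "\<dots> \<le> exp (- 2 * (sqrt (real (card S) * t))\<^sup>2 / real (card S))"
      using fin False t H lhs_closed by (intro rhs_tail) (auto simp: S_def)
    also have "- 2 * (sqrt (real (card S) * t))\<^sup>2 / real (card S) = - 2 * t"
      using t pos by simp
    finally show ?thesis .
  qed
qed

text \<open>Summed over the classes, the main terms give \<open>card H / q\<close>; by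
  Cauchy-Schwarz the deviations give at most \<open>sqrt (M ^ k * (card H * t))\<close>.\<close>

lemma alg_val_le_unless_exceeds:
  assumes H: "H \<subseteq> sparse_vectors F n k" "H \<noteq> {}" and t: "0 \<le> t"
    and good: "\<And>N Y. N < M ^ k \<Longrightarrow> Y < (q ^ B) ^ k \<Longrightarrow> b \<notin> exceeds H t N Y"
  shows "alg_val (H, b) \<le> 1 / real q + sqrt (real (M ^ k) * t / real (card H))"
proof -
  let ?h = "\<lambda>N. real (class_size H N)"
  have fin: "finite H" using H finite_sparse finite_subset by blast
  then have pos: "card H > 0" using H by (simp add: card_gt_0_iff)
  have sum: "(\<Sum>N<M ^ k. ?h N) = real (card H)"
    using sum_class_size[OF H(1)] by (metis of_nat_sum)
  have "real (best H b N ((q ^ B) ^ k)) \<le> ?h N / real q + sqrt (?h N * t)" if N: "N < M ^ k" for N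
  proof -
    let ?r = "?h N / real q + sqrt (?h N * t)"
    have r: "0 \<le> ?r" using t by simp
    \<comment> \<open>Counts are integers, so the real bound may be rounded down to fit
      \<open>best_le\<close>.\<close>
    have "best H b N ((q ^ B) ^ k) \<le> nat \<lfloor>?r\<rfloor>"
      using good[OF N] by (intro best_le) (auto simp: exceeds_def le_nat_floor not_less)
    then show ?thesis using r by linarith
  qed
  then have "(\<Sum>N<M ^ k. real (best H b N ((q ^ B) ^ k)))
      \<le> (\<Sum>N<M ^ k. ?h N / real q + sqrt (?h N * t))"
    by (intro sum_mono) auto
  also have "\<dots> = real (card H) / real q + (\<Sum>N<M ^ k. sqrt (?h N * t))"
    by (simp add: sum.distrib flip: sum sum_divide_distrib)
  also have "(\<Sum>N<M ^ k. sqrt (?h N * t)) \<le> sqrt (card {..<M ^ k} * (\<Sum>N<M ^ k. ?h N * t))"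
    using t by (intro sum_sqrt_le) auto
  also have "(\<Sum>N<M ^ k. ?h N * t) = real (card H) * t"
    by (simp flip: sum sum_distrib_right)
  finally have "(\<Sum>N<M ^ k. real (best H b N ((q ^ B) ^ k)))
      \<le> real (card H) / real q + sqrt (real (M ^ k) * (real (card H) * t))"
    by simp
  then have "alg_val (H, b)
      \<le> (real (card H) / real q + sqrt (real (M ^ k) * (real (card H) * t))) / real (card H)"
    by (simp add: alg_val_def divide_right_mono)
  also have "\<dots> = 1 / real q + sqrt (real (M ^ k) * (real (card H) * t)) / sqrt ((real (card H))\<^sup>2)"
    using pos by (simp add: add_divide_distrib)
  also have "sqrt (real (M ^ k) * (real (card H) * t)) / sqrt ((real (card H))\<^sup>2)
      = sqrt (real (M ^ k) * t / real (card H))"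
    using pos by (subst real_sqrt_divide[symmetric]) (simp add: power2_eq_square field_simps)
  finally show ?thesis .
qed

text \<open>As \<open>B \<ge> 1\<close>, rounding down costs a factor 2 in
  \<open>l < k * (B + 1) \<le> 2 * k * B\<close>, and the extra block costs another in
  \<open>M * B \<le> n + B \<le> 2 * n\<close>.\<close>

lemma M_le: "real M * real l \<le> 4 * real k * real n"
proof -
  have "l < k * (B + 1)"
    using k_pos unfolding B_def by (metis Suc_eq_plus1 dividend_less_times_div mult_Suc_right add.commute)
  also have "\<dots> \<le> k * (2 * B)" using B_pos by (intro mult_le_mono2) simp
  finally have l: "l \<le> 2 * k * B" by simp
  have "B \<le> n"
    using l_le_n div_le_dividend[of l k] unfolding B_def by linarith
  moreover have "n div B * B \<le> n" by (rule div_times_less_eq_dividend)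
  ultimately have MB: "M * B \<le> 2 * n" unfolding M_def add_mult_distrib by linarith
  have "M * l \<le> M * (2 * k * B)" using l by (rule mult_le_mono2)
  also have "\<dots> = 2 * k * (M * B)" by simp
  also have "\<dots> \<le> 2 * k * (2 * n)" using MB by (rule mult_le_mono2)
  finally have "M * l \<le> 4 * k * n" by simp
  then show ?thesis by (metis of_nat_le_iff of_nat_mult of_nat_numeral)
qed

lemma qn_ge: "n + 1 \<le> q * n" "2 \<le> n"
proof -
  show n: "2 \<le> n" using k_pos k_le_l l_le_n by linarith
  have "2 * n \<le> q * n" using q_ge_2 by (rule mult_le_mono1)
  with n show "n + 1 \<le> q * n" by linarith
qed

text \<open>\<open>M \<le> n + 1 \<le> q * n\<close> and \<open>k \<le> l\<close>.\<close>

lemma M_power_le: "M ^ k \<le> (q * n) ^ l"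
proof -
  have "M \<le> q * n" using qn_ge(1) by (simp add: M_def) (meson div_le_dividend le_trans Suc_le_mono)
  then have "M ^ k \<le> (q * n) ^ k" by (intro power_mono) auto
  also have "\<dots> \<le> (q * n) ^ l" using qn_ge(1) k_le_l by (intro power_increasing) linarith+
  finally show ?thesis .
qed

lemma Q_power_le: "(q ^ B) ^ k \<le> (q * n) ^ l"
proof -
  have "(q ^ B) ^ k = q ^ (k * B)" by (simp add: mult.commute flip: power_mult)
  also have "\<dots> \<le> q ^ l" using kB_le_l q_ge_2 by (intro power_increasing) auto
  also have "\<dots> \<le> (q * n) ^ l" using qn_ge by (intro power_mono) auto
  finally show ?thesis .
qed

text \<open>The total deviation is \<open>sqrt (M ^ k * t / card H)\<close> with \<open>t\<close> of
  order \<open>l * ln (q * n)\<close>. Since \<open>M\<close> is at most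
  \<open>4 * k * n / l\<close>, the assumed size brings it down to
  \<open>\<epsilon>\<close>.\<close>

lemma semirandom_bound:
  assumes H: "H \<subseteq> sparse_vectors F n k" and \<epsilon>: "0 < \<epsilon>"
    and size: "real (card H) \<ge> 2 * (4 * real k) ^ k * real n * (real n / real l) ^ (k - 1)
      * ln (real (q * n)) * (1 / \<epsilon> ^ 2)"
  shows "measure_pmf.prob (semirandom_LIN F H) {I. alg_val I \<le> 1 / real q + \<epsilon>} \<ge> 1 - 1 / real n"
proof -
  \<comment> \<open>Each event then has probability at most \<open>1 / (q * n) ^ (4 * l)\<close>,
    while there are at most \<open>(q * n) ^ (2 * l)\<close> pairs of a class and an
    assignment.\<close>
  define t where "t = 2 * real l * ln (real (q * n))"
  define bad where "bad = (\<Union>(N, Y) \<in> {..<M ^ k} \<times> {..<(q ^ B) ^ k}. exceeds H t N Y)"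
  have l: "l > 0" using k_pos k_le_l by simp
  have X: "1 < real (q * n)" using qn_ge by linarith
  then have ln: "0 < ln (real (q * n))" by simp
  then have t: "0 \<le> t" by (simp add: t_def)
  have Mkt: "real (M ^ k) * t \<le> 2 * (4 * real k) ^ k * real n * (real n / real l) ^ (k - 1)
      * ln (real (q * n))"
  proof -
    have "real M \<le> 4 * real k * (real n / real l)"
      using M_le l by (simp add: field_simps)
    then have "real (M ^ k) \<le> (4 * real k * (real n / real l)) ^ k"
      by (simp add: power_mono)
    also have "\<dots> = (4 * real k) ^ k * ((real n / real l) ^ (k - 1) * (real n / real l))"
      unfolding power_mult_distrib using k_pos by (simp only: power_minus_mult)
    finally have "real (M ^ k) * t \<le>
        (4 * real k) ^ k * ((real n / real l) ^ (k - 1) * (real n / real l)) * t"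
      using t by (rule mult_right_mono)
    also have "\<dots> = 2 * (4 * real k) ^ k * real n * (real n / real l) ^ (k - 1) * ln (real (q * n))"
      using l by (simp add: t_def)
    finally show ?thesis .
  qed
  have "0 < 2 * (4 * real k) ^ k * real n * (real n / real l) ^ (k - 1) * ln (real (q * n)) * (1 / \<epsilon> ^ 2)"
    using k_pos l ln \<epsilon> qn_ge by (intro mult_pos_pos) auto
  with size have pos: "0 < real (card H)" by linarith
  then have ne: "H \<noteq> {}" by auto
  have "real (M ^ k) * t / \<epsilon> ^ 2 \<le> real (card H)"
    using size Mkt \<epsilon> by (auto simp: divide_right_mono elim!: order_trans[rotated])
  then have err: "sqrt (real (M ^ k) * t / real (card H)) \<le> \<epsilon>"
    using pos \<epsilon> by (intro real_le_lsqrt) (auto simp: field_simps)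
  have "alg_val (H, b) \<le> 1 / real q + \<epsilon>" if "b \<notin> bad" for b
    using alg_val_le_unless_exceeds[OF H ne t, of b] that err by (force simp: bad_def)
  then have "- bad \<subseteq> (\<lambda>b. (H, b)) -` {I. alg_val I \<le> 1 / real q + \<epsilon>}"
    by auto
  then have "measure_pmf.prob (rhs_pmf H) (- bad)
      \<le> measure_pmf.prob (semirandom_LIN F H) {I. alg_val I \<le> 1 / real q + \<epsilon>}"
    unfolding semirandom_LIN_def measure_map_pmf by (intro measure_pmf.finite_measure_mono) auto
  moreover have "measure_pmf.prob (rhs_pmf H) (- bad) = 1 - measure_pmf.prob (rhs_pmf H) bad"
    using measure_pmf.prob_compl[of bad "rhs_pmf H"] by (simp add: Compl_eq_Diff_UNIV)
  moreover have "measure_pmf.prob (rhs_pmf H) bad \<le> 1 / real n"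
  proof -
    have "measure_pmf.prob (rhs_pmf H) bad \<le>
        (\<Sum>(N, Y) \<in> {..<M ^ k} \<times> {..<(q ^ B) ^ k}. measure_pmf.prob (rhs_pmf H) (exceeds H t N Y))"
      unfolding bad_def split_beta by (intro measure_UNION_le) auto
    also have "\<dots> \<le> (\<Sum>(N, Y) \<in> {..<M ^ k} \<times> {..<(q ^ B) ^ k}. exp (- 2 * t))"
      unfolding split_beta by (intro sum_mono prob_exceeds H t)
    also have "\<dots> = real (M ^ k) * real ((q ^ B) ^ k) * exp (- 2 * t)"
      by (simp add: split_beta)
    also have "\<dots> \<le> real (q * n) ^ l * real (q * n) ^ l * exp (- 2 * t)"
      by (intro mult_right_mono mult_mono) (use M_power_le Q_power_le in \<open>simp_all flip: of_nat_power of_nat_mult\<close>)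
    also have "exp (- 2 * t) = 1 / real (q * n) ^ (4 * l)"
    proof -
      have "- 2 * t = - (real (4 * l) * ln (real (q * n)))" by (simp add: t_def)
      then have "exp (- 2 * t) = inverse (exp (real (4 * l) * ln (real (q * n))))"
        by (simp only: exp_minus)
      also have "exp (real (4 * l) * ln (real (q * n))) = real (q * n) ^ (4 * l)"
        using X by (subst exp_of_nat_mult) simp
      finally show ?thesis by (simp only: inverse_eq_divide)
    qed
    also have "real (q * n) ^ l * real (q * n) ^ l * (1 / real (q * n) ^ (4 * l)) = 1 / real (q * n) ^ (2 * l)"
    proof -
      have "4 * l = l + l + 2 * l" by simp
      then have "real (q * n) ^ (4 * l) = real (q * n) ^ l * real (q * n) ^ l * real (q * n) ^ (2 * l)"
        by (simp only: power_add)
      then show ?thesis using X by (simp del: of_nat_mult)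
    qed
    also have "\<dots> \<le> 1 / real n"
    proof -
      have "real n \<le> real (q * n) ^ 1"
        using qn_ge(1) by (simp only: power_one_right of_nat_le_iff)
      also have "\<dots> \<le> real (q * n) ^ (2 * l)" using X l by (intro power_increasing) auto
      finally show ?thesis using qn_ge by (intro divide_left_mono) auto
    qed
    finally show ?thesis .
  qed
  ultimately show ?thesis by linarith
qed

text \<open>Given its left-hand sides, a random instance is semirandom, and
  \<open>semirandom_bound\<close> applies to every choice of them.\<close>

lemma random_bound:
  assumes m: "m \<le> card (sparse_vectors F n k)" and \<epsilon>: "0 < \<epsilon>"
    and size: "real m \<ge> 2 * (4 * real k) ^ k * real n * (real n / real l) ^ (k - 1)
      * ln (real (q * n)) * (1 / \<epsilon> ^ 2)"
  shows "measure_pmf.prob (random_LIN F n k m) {I. alg_val I \<le> 1 / real q + \<epsilon>} \<ge> 1 - 1 / real n"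
  unfolding random_LIN_def
proof (rule prob_bind_pmf_ge)
  let ?A = "{H. H \<subseteq> sparse_vectors F n k \<and> card H = m}"
  \<comment> \<open>By the bound on \<open>m\<close> there is a set to choose, so that
    \<open>pmf_of_set\<close> is the uniform distribution.\<close>
  obtain H where "H \<subseteq> sparse_vectors F n k" "card H = m"
    using obtain_subset_with_card_n[OF m] by auto
  then have "?A \<noteq> {}" by blast
  moreover have "finite ?A" using finite_sparse by simp
  ultimately show "1 - 1 / real n \<le> measure_pmf.prob (semirandom_LIN F H) {I. alg_val I \<le> 1 / real q + \<epsilon>}"
    if "H \<in> set_pmf (pmf_of_set ?A)" for H
    using that size by (intro semirandom_bound \<epsilon>) auto
  show "0 \<le> 1 - 1 / real n" using qn_ge by simp
qed

end

section \<open>The algorithm as a program\<close>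

lemma length_concat_map_uniform:
  assumes "\<And>x. x \<in> set xs \<Longrightarrow> length (f x) = c"
  shows "length (concat (map f xs)) = length xs * c"
  using assms by (induction xs) auto

text \<open>Row-major addressing, for the two field tables and for the list of equations.\<close>

lemma nth_concat_map_uniform:
  assumes "\<And>x. x \<in> set xs \<Longrightarrow> length (f x) = c" "i < length xs" "j < c"
  shows "concat (map f xs) ! (i * c + j) = f (xs ! i) ! j"
  using assms
proof (induction xs arbitrary: i)
  case (Cons x xs)
  then show ?case
    by (cases i) (auto simp: nth_append)
qed simp

lemma nth_segment:
  "length xs = m \<Longrightarrow> i < length ys \<Longrightarrow> (xs @ ys @ zs) ! (m + i) = ys ! i"
  by (simp add: nth_append)

lemma nth_last_segment:
  assumes "length xs = a" "length ys = c" "length zs = d"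
  shows "(xs @ ys @ zs @ us) ! (a + (c + (d + i))) = us ! i"
  unfolding assms[symmetric] nth_append_length_plus ..

section \<open>Registers, memory layout and the program\<close>

abbreviation (input) "r_total \<equiv> 0::nat"
abbreviation (input) "r_denom \<equiv> 1::nat"
abbreviation (input) "r_Q \<equiv> 2::nat"
abbreviation (input) "r_M \<equiv> 3::nat"
abbreviation (input) "r_B \<equiv> 4::nat"
abbreviation (input) "r_N \<equiv> 5::nat"
abbreviation (input) "r_Y \<equiv> 6::nat"
abbreviation (input) "r_eqn \<equiv> 7::nat"
abbreviation (input) "r_var \<equiv> 8::nat"
abbreviation (input) "r_code \<equiv> 9::nat"
abbreviation (input) "r_lhs \<equiv> 10::nat"
abbreviation (input) "r_digits \<equiv> 11::nat"
abbreviation (input) "r_weight \<equiv> 12::nat"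
abbreviation (input) "r_best \<equiv> 13::nat"
abbreviation (input) "r_count \<equiv> 14::nat"
abbreviation (input) "r_row \<equiv> 15::nat"
abbreviation (input) "r_coeff \<equiv> 16::nat"

abbreviation (input) "n_expr \<equiv> Mem (Const 0)"
abbreviation (input) "l_expr \<equiv> Mem (Const 1)"
abbreviation (input) "q_expr \<equiv> Mem (Const 2)"

text \<open>A table lookup. The addition table starts after the three header cells, the
  multiplication table \<open>q * q\<close> cells later.\<close>

definition add_expr :: "expr \<Rightarrow> expr \<Rightarrow> expr" where
  "add_expr e f = Mem (Plus (Const 3) (Plus (Times e q_expr) f))"

definition mult_expr :: "expr \<Rightarrow> expr \<Rightarrow> expr" where
  "mult_expr e f = Mem (Plus (Plus (Const 3) (Times q_expr q_expr)) (Plus (Times e q_expr) f))"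

text \<open>The number of equations follows the two tables; the equations start one cell
  later.\<close>

definition size_expr :: expr where
  "size_expr = Mem (Plus (Const 3) (Times (Const 2) (Times q_expr q_expr)))"

definition rows_expr :: expr where
  "rows_expr = Plus (Const 4) (Times (Const 2) (Times q_expr q_expr))"

definition mod_expr :: "expr \<Rightarrow> expr \<Rightarrow> expr" where
  "mod_expr e f = Minus e (Times (Div e f) f)"

text \<open>Since subtraction is truncated, this is the distance of the two values.\<close>

definition diff_expr :: "expr \<Rightarrow> expr \<Rightarrow> expr" where
  "diff_expr e f = Plus (Minus e f) (Minus f e)"

primrec power_expr :: "expr \<Rightarrow> nat \<Rightarrow> expr" where
  "power_expr e 0 = Const 1"
| "power_expr e (Suc j) = Times e (power_expr e j)"

lemma eval_mod_expr: "eval (mod_expr e f) s = eval e s mod eval f s"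
  by (simp add: mod_expr_def minus_div_mult_eq_mod)

lemma eval_diff_expr: "eval (diff_expr e f) s = 0 \<longleftrightarrow> eval e s = eval f s"
  by (auto simp: diff_expr_def)

text \<open>Truncated subtraction from 1 yields an indicator, which can be added to a counter
  without branching.\<close>

definition both_equal_expr :: "expr \<Rightarrow> expr \<Rightarrow> expr \<Rightarrow> expr \<Rightarrow> expr" where
  "both_equal_expr e f g h = Minus (Const 1) (Plus (diff_expr e f) (diff_expr g h))"

lemma eval_both_equal_expr:
  "eval (both_equal_expr e f g h) s = of_bool (eval e s = eval f s \<and> eval g s = eval h s)"
  using eval_diff_expr[of e f s] eval_diff_expr[of g h s]
  by (cases "eval (diff_expr e f) s + eval (diff_expr g h) s") (auto simp: both_equal_expr_def)

lemma eval_power_expr: "eval (power_expr e j) s = eval e s ^ j"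
  by (induction j) auto

text \<open>
  The weight of variable \<open>i\<close> is \<open>q ^ (i mod B)\<close>; multiplication by \<open>q\<close> advances it, except that
  \<open>q ^ B\<close> has to be replaced by 1.
\<close>

definition next_weight_expr :: expr where
  "next_weight_expr =
     (let w = Times (Reg r_weight) q_expr
      in Minus w (Times (Div w (Reg r_Q)) (Minus (Reg r_Q) (Const 1))))"

text \<open>The number of the field's zero is not part of the input; the machine recognizes zero as
  the element with \<open>x \<oplus> x = x\<close>. Dividing \<open>r_digits\<close> by
  \<open>q ^ B\<close> after each nonzero coefficient exposes the next slot.\<close>

definition scan_var :: prog where
  "scan_var =
     Seq (SetReg r_coeff (Mem (Plus (Reg r_row) (Reg r_var))))
    (Seq (Cond (diff_expr (add_expr (Reg r_coeff) (Reg r_coeff)) (Reg r_coeff))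
       (Seq (SetReg r_code (Plus (Times (Reg r_code) (Reg r_M)) (Div (Reg r_var) (Reg r_B))))
       (Seq (SetReg r_lhs (add_expr (Reg r_lhs) (mult_expr (Reg r_coeff)
               (mod_expr (Div (Reg r_digits) (Reg r_weight)) q_expr))))
            (SetReg r_digits (Div (Reg r_digits) (Reg r_Q)))))
       Skip)
    (Seq (SetReg r_weight next_weight_expr)
         (SetReg r_var (Plus (Reg r_var) (Const 1)))))"

definition start_eqn :: prog where
  "start_eqn =
     Seq (SetReg r_row (Plus rows_expr (Times (Reg r_eqn) (Plus n_expr (Const 1)))))
    (Seq (SetReg r_code (Const 0))
    (Seq (SetReg r_lhs (Const 0))
    (Seq (SetReg r_digits (Reg r_Y))
    (Seq (SetReg r_weight (Const 1))
         (SetReg r_var (Const 0))))))"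

text \<open>The right-hand side sits right after the \<open>n\<close> coefficients. Adding the
  element numbered 0 matches the shift in \<open>lhs\<close>.\<close>

definition finish_eqn :: prog where
  "finish_eqn =
     Seq (SetReg r_count (Plus (Reg r_count)
           (both_equal_expr (Reg r_code) (Reg r_N)
             (Reg r_lhs) (add_expr (Const 0) (Mem (Plus (Reg r_row) n_expr))))))
         (SetReg r_eqn (Plus (Reg r_eqn) (Const 1)))"

definition scan_eqn :: prog where
  "scan_eqn = Seq start_eqn (Seq (While (Minus n_expr (Reg r_var)) scan_var) finish_eqn)"

text \<open>The update of \<open>r_best\<close> computes a maximum by truncated subtraction.\<close>

definition scan_assignment :: prog where
  "scan_assignment =
     Seq (Seq (SetReg r_count (Const 0)) (SetReg r_eqn (Const 0)))
    (Seq (While (Minus size_expr (Reg r_eqn)) scan_eqn)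
         (Seq (SetReg r_best (Plus (Reg r_best) (Minus (Reg r_count) (Reg r_best))))
              (SetReg r_Y (Plus (Reg r_Y) (Const 1)))))"

definition scan_class :: "nat \<Rightarrow> prog" where
  "scan_class k =
     Seq (Seq (SetReg r_best (Const 0)) (SetReg r_Y (Const 0)))
    (Seq (While (Minus (power_expr (Reg r_Q) k) (Reg r_Y)) scan_assignment)
         (Seq (SetReg r_total (Plus (Reg r_total) (Reg r_best)))
              (SetReg r_N (Plus (Reg r_N) (Const 1)))))"

text \<open>The counters rely on all registers being 0 initially. The final denominator is the
  number of equations, or 1 if there are none.\<close>

definition refutation_prog :: "nat \<Rightarrow> prog" where
  "refutation_prog k =
     Seq (Seq (SetReg r_B (Div l_expr (Const k)))
         (Seq (SetReg r_M (Plus (Div n_expr (Reg r_B)) (Const 1)))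
              (SetReg r_Q (Const 1))))
    (Seq (While (Minus (Reg r_B) (Reg r_var))
            (Seq (SetReg r_Q (Times (Reg r_Q) q_expr))
                 (SetReg r_var (Plus (Reg r_var) (Const 1)))))
    (Seq (While (Minus (power_expr (Reg r_M) k) (Reg r_N)) (scan_class k))
         (SetReg r_denom (Plus size_expr (Minus (Const 1) size_expr)))))"

text \<open>The bounds on \<open>L\<close> cover variable indices, class codes, assignments and
  input addresses, in this order.\<close>

locale refutation_input = block_refutation +
  fixes vs :: "(nat \<Rightarrow> nat) list" and b :: "(nat \<Rightarrow> nat) \<Rightarrow> nat" and L :: nat
  assumes distinct_vs: "distinct vs"
    and vs_sparse: "set vs \<subseteq> sparse_vectors F n k"
    and b_carrier: "v \<in> set vs \<Longrightarrow> b v \<in> carrier F"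
    and L_bounds: "n < 2 ^ L" "M ^ k < 2 ^ L" "(q ^ B) ^ k < 2 ^ L"
      "4 + 2 * (q * q) + length vs * (n + 1) < 2 ^ L"
begin

section \<open>Contents of the input memory\<close>

definition input :: "nat \<Rightarrow> nat" where
  "input = mem (initial (encode F n l vs b))"

lemma encode_append:
  "encode F n l vs b = [n, l, q]
     @ concat (map (\<lambda>x. map (\<lambda>y. x \<oplus> y) [0..<q]) [0..<q])
     @ concat (map (\<lambda>x. map (\<lambda>y. x \<otimes> y) [0..<q]) [0..<q])
     @ [length vs] @ concat (map (\<lambda>v. map v [0..<n] @ [b v]) vs)"
  by (simp add: encode_def q_def)

lemma table_length: "length (concat (map (\<lambda>x. map (f x) [0..<q]) [0..<q])) = q * q"
  by (subst length_concat_map_uniform[where c = q]) auto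

lemma table_nth:
  "x < q \<Longrightarrow> y < q \<Longrightarrow> concat (map (\<lambda>x. map (f x) [0..<q]) [0..<q]) ! (x * q + y) = f x y"
  by (subst nth_concat_map_uniform[where c = q]) auto

lemma rows_length: "length (concat (map (\<lambda>v. map v [0..<n] @ [b v]) vs)) = length vs * (n + 1)"
  by (subst length_concat_map_uniform[where c = "n + 1"]) auto

lemma rows_nth:
  assumes "e < length vs" "i \<le> n"
  shows "concat (map (\<lambda>v. map v [0..<n] @ [b v]) vs) ! (e * (n + 1) + i) =
    (if i < n then (vs ! e) i else b (vs ! e))"
  using assms by (subst nth_concat_map_uniform[where c = "n + 1"]) (auto simp: nth_append)

lemma input_nth:
  assumes "a < length (encode F n l vs b)"
  shows "input a = encode F n l vs b ! a"
  using assms by (simp add: input_def initial_def)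

lemma encode_length:
  "length (encode F n l vs b) = 4 + 2 * (q * q) + length vs * (n + 1)"
  unfolding encode_append by (simp only: length_append table_length rows_length) simp

lemma input_header: "input 0 = n" "input (Suc 0) = l" "input 2 = q"
proof -
  have "0 < length (encode F n l vs b)" "1 < length (encode F n l vs b)"
    "2 < length (encode F n l vs b)"
    unfolding encode_length by simp_all
  then have "input 0 = encode F n l vs b ! 0" "input 1 = encode F n l vs b ! 1"
    "input 2 = encode F n l vs b ! 2"
    by (simp_all only: input_nth)
  then show "input 0 = n" "input (Suc 0) = l" "input 2 = q"
    unfolding encode_append by simp_all
qed

lemma input_add:
  assumes "x < q" "y < q"
  shows "input (3 + (x * q + y)) = x \<oplus> y"
proof -
  have *: "x * q + y < q * q" using assms by (rule radix_less)
  then have "input (3 + (x * q + y)) = encode F n l vs b ! (3 + (x * q + y))"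
    by (intro input_nth) (simp add: encode_length)
  also have "\<dots> = concat (map (\<lambda>x. map (\<lambda>y. x \<oplus> y) [0..<q]) [0..<q]) ! (x * q + y)"
    unfolding encode_append by (rule nth_segment) (simp_all add: table_length *)
  also have "\<dots> = x \<oplus> y" using assms by (rule table_nth)
  finally show ?thesis .
qed

lemma input_mult:
  assumes "x < q" "y < q"
  shows "input (3 + q * q + (x * q + y)) = x \<otimes> y"
proof -
  have *: "x * q + y < q * q" using assms by (rule radix_less)
  then have "input (3 + q * q + (x * q + y)) = encode F n l vs b ! (3 + q * q + (x * q + y))"
    by (intro input_nth) (simp add: encode_length)
  also have "\<dots> = concat (map (\<lambda>x. map (\<lambda>y. x \<otimes> y) [0..<q]) [0..<q]) ! (x * q + y)"
    unfolding encode_append append_assoc[of "[n, l, q]", symmetric]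
    by (rule nth_segment) (simp_all add: table_length *)
  also have "\<dots> = x \<otimes> y" using assms by (rule table_nth)
  finally show ?thesis .
qed

lemma input_size: "input (3 + 2 * (q * q)) = length vs"
proof -
  have "input (3 + 2 * (q * q)) = encode F n l vs b ! (3 + 2 * (q * q))"
    by (intro input_nth) (simp add: encode_length)
  also have "\<dots> = encode F n l vs b ! (3 + (q * q + (q * q + 0)))"
    by (rule arg_cong[where f = "(!) _"]) simp
  also have "\<dots> = ([length vs]
      @ concat (map (\<lambda>v. map v [0..<n] @ [b v]) vs)) ! 0"
    unfolding encode_append by (rule nth_last_segment) (simp_all only: table_length, simp)
  finally show ?thesis by simp
qed

lemma input_row:
  assumes "e < length vs" "i \<le> n"
  shows "input (4 + 2 * (q * q) + e * (n + 1) + i) = (if i < n then (vs ! e) i else b (vs ! e))"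
proof -
  have *: "e * (n + 1) + i < length vs * (n + 1)" using assms by (intro radix_less) auto
  then have "input (4 + 2 * (q * q) + e * (n + 1) + i) =
      encode F n l vs b ! (4 + 2 * (q * q) + e * (n + 1) + i)"
    by (intro input_nth) (simp add: encode_length)
  also have "\<dots> = encode F n l vs b ! (3 + (q * q + (q * q + Suc (e * (n + 1) + i))))"
    by (rule arg_cong[where f = "(!) _"]) simp
  also have "\<dots> = ([length vs]
      @ concat (map (\<lambda>v. map v [0..<n] @ [b v]) vs)) ! Suc (e * (n + 1) + i)"
    unfolding encode_append by (rule nth_last_segment) (simp_all only: table_length, simp)
  also have "\<dots> = concat (map (\<lambda>v. map v [0..<n] @ [b v]) vs) ! (e * (n + 1) + i)"
    by simp
  also have "\<dots> = (if i < n then (vs ! e) i else b (vs ! e))"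
    by (rule rows_nth[OF assms])
  finally show ?thesis .
qed

lemma less_2L:
  "x \<le> M ^ k \<Longrightarrow> x < 2 ^ L" "x \<le> (q ^ B) ^ k \<Longrightarrow> x < 2 ^ L"
  "x \<le> 4 + 2 * (q * q) + length vs * (n + 1) \<Longrightarrow> x < 2 ^ L"
  using L_bounds by (auto intro: le_less_trans)

lemma q_less_2L: "q < 2 ^ L"
  by (rule less_2L(3)) (simp add: trans_le_add1 trans_le_add2)


text \<open>Each entry of the encoding is \<open>n\<close>, \<open>l\<close>, \<open>q\<close>, a
  field element or the number of equations; the memory beyond is 0.\<close>

lemma input_less_2L: "input a < 2 ^ L"
proof (cases "a < length (encode F n l vs b)")
  case True
  have b: "b v < q" "i < n \<Longrightarrow> v i < q" if "v \<in> set vs" for v i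
    using that b_carrier[of v] sparse_closed vs_sparse carrier_eq by auto
  have "x \<oplus> y < q" "x \<otimes> y < q" if "x < q" "y < q" for x y
    using that a_closed[of x y] m_closed[of x y] unfolding carrier_eq by simp_all
  moreover have "length vs \<le> length vs * (n + 1)" by simp
  ultimately have "\<forall>x \<in> set (encode F n l vs b). x \<le> n \<or> x \<le> q \<or> x \<le> length vs * (n + 1)"
    unfolding encode_append using l_le_n b by (auto intro: less_imp_le)
  then have "encode F n l vs b ! a \<le> n \<or> encode F n l vs b ! a \<le> q \<or>
      encode F n l vs b ! a \<le> length vs * (n + 1)"
    using nth_mem[OF True] by blast
  then have "encode F n l vs b ! a < 2 ^ L"
    using L_bounds q_less_2L by linarith
  then show ?thesis using input_nth[OF True] by simp
qed (simp add: input_def initial_def)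

lemma B_less_2L: "B < 2 ^ L"
  using L_bounds(1) k_le_l l_le_n by (auto simp: B_def intro: le_less_trans[OF div_le_dividend])

lemma add_eq_self_iff: "x \<in> carrier F \<Longrightarrow> x \<oplus> x = x \<longleftrightarrow> x = \<zero>"
  by (metis a_assoc r_neg r_zero a_inv_closed add.l_cancel_one)

text \<open>Below the wrap-around the product is less than \<open>q ^ B\<close> and the quotient is
  0; at the wrap-around the quotient is 1 and 1 remains.\<close>

lemma next_weight:
  "q ^ (i mod B) * q - q ^ (i mod B) * q div q ^ B * (q ^ B - 1) = q ^ (Suc i mod B)"
proof (cases "Suc (i mod B) = B")
  case True
  then have "q ^ (i mod B) * q = q ^ B" by (metis power_Suc2)
  moreover have "Suc i mod B = 0" using True by (simp add: mod_Suc)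
  ultimately show ?thesis using q_ge_2 by simp
next
  case False
  then have "Suc (i mod B) < B" using B_pos by (meson Suc_lessI mod_less_divisor)
  moreover have "Suc i mod B = Suc (i mod B)" using False by (simp add: mod_Suc)
  moreover from calculation have "q * q ^ (i mod B) < q ^ B"
    using q_ge_2 power_strict_increasing[of "Suc (i mod B)" B q] by simp
  ultimately show ?thesis by (simp add: mult.commute)
qed

section \<open>Loop invariants and correctness of the program\<close>

definition count :: "nat \<Rightarrow> nat \<Rightarrow> nat \<Rightarrow> nat" where
  "count N Y e = card {v \<in> set (take e vs). agrees b N Y v}"

text \<open>The upper limit of the sum is the argument; the summation variable merely has the same
  name.\<close>

definition total :: "nat \<Rightarrow> nat" where
  "total N = (\<Sum>N<N. best (set vs) b N ((q ^ B) ^ k))"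

text \<open>The invariants of the nested loops, each extending that of the enclosing loop; the last
  index counts completed rounds.\<close>

definition at_class :: "nat \<Rightarrow> (nat \<Rightarrow> nat) \<Rightarrow> bool" where
  "at_class N R \<longleftrightarrow> R r_Q = q ^ B \<and> R r_M = M \<and> R r_B = B \<and> R r_N = N \<and> R r_total = total N"

definition at_assignment :: "nat \<Rightarrow> nat \<Rightarrow> (nat \<Rightarrow> nat) \<Rightarrow> bool" where
  "at_assignment N Y R \<longleftrightarrow> at_class N R \<and> R r_Y = Y \<and> R r_best = best (set vs) b N Y"

definition at_eqn :: "nat \<Rightarrow> nat \<Rightarrow> nat \<Rightarrow> (nat \<Rightarrow> nat) \<Rightarrow> bool" where
  "at_eqn N Y e R \<longleftrightarrow> at_assignment N Y R \<and> R r_eqn = e \<and> R r_count = count N Y e"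

definition at_var :: "nat \<Rightarrow> nat \<Rightarrow> nat \<Rightarrow> nat \<Rightarrow> (nat \<Rightarrow> nat) \<Rightarrow> bool" where
  "at_var N Y e i R \<longleftrightarrow> at_eqn N Y e R \<and> R r_var = i \<and>
     R r_row = 4 + 2 * (q * q) + e * (n + 1) \<and>
     R r_code = code (vs ! e) i \<and> R r_lhs = lhs (vs ! e) Y i \<and>
     R r_digits = Y div (q ^ B) ^ rank (vs ! e) i \<and> R r_weight = q ^ (i mod B)"

lemmas at_defs = at_class_def at_assignment_def at_eqn_def at_var_def

text \<open>Since \<open>vs\<close> is distinct, equation \<open>e\<close> is not among the earlier
  ones, and counting list positions agrees with counting set elements.\<close>

lemma count_Suc:
  assumes "e < length vs"
  shows "count N Y (Suc e) = count N Y e + of_bool (agrees b N Y (vs ! e))"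
proof -
  have "vs ! e \<notin> set (take e vs)"
    using distinct_vs assms by (metis distinct_take id_take_nth_drop not_distinct_conv_prefix take_Suc_conv_app_nth)
  moreover have "{v \<in> set (take (Suc e) vs). agrees b N Y v} =
    (if agrees b N Y (vs ! e) then insert (vs ! e) {v \<in> set (take e vs). agrees b N Y v}
     else {v \<in> set (take e vs). agrees b N Y v})"
    using assms by (auto simp: take_Suc_conv_app_nth)
  ultimately show ?thesis by (simp add: count_def)
qed

lemma count_le: "count N Y e \<le> length vs"
proof -
  have "count N Y e \<le> card (set (take e vs))"
    unfolding count_def by (intro card_mono) auto
  also have "\<dots> \<le> length (take e vs)" by (rule card_length)
  also have "\<dots> \<le> length vs" by simp
  finally show ?thesis .
qed

lemma best_le_length: "best (set vs) b N y \<le> length vs"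
proof -
  have "best (set vs) b N y \<le> card (set vs)"
    by (intro best_le card_mono) auto
  also have "\<dots> \<le> length vs" by (rule card_length)
  finally show ?thesis .
qed

lemma total_le:
  assumes "N \<le> M ^ k"
  shows "total N \<le> length vs"
proof -
  have "total N \<le> total (M ^ k)"
    unfolding total_def using assms by (intro sum_mono2) auto
  also have "\<dots> \<le> card (set vs)"
    unfolding total_def by (rule sum_best_le_card[OF vs_sparse])
  also have "\<dots> \<le> length vs" by (rule card_length)
  finally show ?thesis .
qed

lemma size_less_2L: "x \<le> length vs \<Longrightarrow> x < 2 ^ L"
  by (rule less_2L(3)) (simp add: trans_le_add1 trans_le_add2)

lemma power_k_ge: "x \<ge> 1 \<Longrightarrow> i \<le> k \<Longrightarrow> x ^ i \<le> (x::nat) ^ k"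
  by (rule power_increasing)

text \<open>The 8 steps are one load, five for the conditional (guard, three assignments and
  \<open>Skip\<close>) and two updates. The facts collected first evaluate the table lookups and
  bound the assigned numbers.\<close>

lemma hoare_scan_var:
  assumes e: "e < length vs" and i: "i < n" and Y: "Y < (q ^ B) ^ k"
  shows "hoare L input 8 (at_var N Y e i) scan_var (at_var N Y e (Suc i))"
proof -
  let ?v = "vs ! e"
  have v: "?v \<in> sparse_vectors F n k" using e vs_sparse by auto
  have vi: "?v i < q" using sparse_closed[OF v i] by (simp add: carrier_eq)
  have row: "input (4 + 2 * (q * q) + e * (n + 1) + i) = ?v i"
    using input_row[OF e, of i] i by simp
  have lhsq: "lhs ?v Y i < q" "lhs ?v Y (Suc i) < q"
    using lhs_closed[OF v, of i Y] lhs_closed[OF v, of "Suc i" Y] i by (simp_all only: carrier_eq) auto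
  have zero: "?v i \<oplus> ?v i = ?v i \<longleftrightarrow> ?v i = \<zero>"
    using add_eq_self_iff vi by (simp add: carrier_eq)
  have dq: "x mod q < q" for x using q_ge_2 by simp
  have mq: "?v i \<otimes> (x mod q) < q" for x
    using m_closed[of "?v i" "x mod q"] vi dq[of x] by (simp add: carrier_eq)
  have a1: "input (3 + (?v i * q + ?v i)) = ?v i \<oplus> ?v i"
    using vi vi by (rule input_add)
  have a2: "input (3 + q * q + (?v i * q + x mod q)) = ?v i \<otimes> (x mod q)" for x
    using vi dq by (rule input_mult)
  have a3: "input (3 + (lhs ?v Y i * q + ?v i \<otimes> (x mod q))) = lhs ?v Y i \<oplus> ?v i \<otimes> (x mod q)" for x
    using lhsq(1) mq by (rule input_add)
  have code: "code ?v (Suc i) < 2 ^ L"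
  proof -
    have "code ?v (Suc i) < M ^ rank ?v (Suc i)" using i by (intro code_less) simp
    also have "\<dots> \<le> M ^ k"
      using rank_mono[of "Suc i" n ?v] rank_n[OF v] i M_pos by (intro power_k_ge) auto
    finally show ?thesis by (intro less_2L(1)) simp
  qed
  have dig: "Y div x < 2 ^ L" for x
    using Y by (intro less_2L(2)) (meson div_le_dividend le_trans less_imp_le)
  have dig2: "Y div x div y < 2 ^ L" for x y
    using dig[of "x * y"] by (simp add: div_mult2_eq)
  have w: "q ^ (Suc i mod B) < 2 ^ L"
  proof -
    have "q ^ (Suc i mod B) \<le> (q ^ B) ^ 1"
      using q_ge_2 B_pos by (simp add: power_increasing less_imp_le)
    also have "\<dots> \<le> (q ^ B) ^ k"
      using q_ge_2 k_pos by (intro power_increasing) auto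
    finally show ?thesis by (rule less_2L(2))
  qed
  have i2: "Suc i < 2 ^ L" using i L_bounds(1) by simp
  have nw: "q ^ (i mod B) * q - q ^ (i mod B) * q div q ^ B * (q ^ B - Suc 0) = q ^ (Suc i mod B)"
    using next_weight[of i] by simp
  show ?thesis
    unfolding scan_var_def
    apply (rule hoare_pre)
      apply (rule hoare_Seq hoare_SetReg hoare_Cond hoare_Skip)+
    subgoal for R
      using a1 a2 a3 zero row code dig w i2 nw vi dig[of 1] dig2 lhsq q_less_2L
      by (cases "?v i = \<zero>")
        (simp_all add: at_defs add_expr_def mult_expr_def next_weight_expr_def Let_def
          eval_mod_expr eval_diff_expr input_header input_less_2L div_mult2_eq mult.commute[of "q ^ B"])
    apply simp
    done
qed

lemma hoare_start_eqn:
  assumes e: "e < length vs" and Y: "Y < (q ^ B) ^ k"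
  shows "hoare L input 6 (at_eqn N Y e) start_eqn (at_var N Y e 0)"
proof -
  have "(e + 1) * (n + 1) \<le> length vs * (n + 1)"
    using e by (intro mult_le_mono1) simp
  then have row: "4 + 2 * (q * q) + (e + e * n) < 2 ^ L"
    by (intro less_2L(3)) simp
  have Y2: "Y < 2 ^ L" using Y by (intro less_2L(2)) simp
  have pos: "(0::nat) < 2 ^ L" "1 < (2::nat) ^ L"
    using qn_ge(2) L_bounds(1) by auto
  show ?thesis
    unfolding start_eqn_def
    apply (rule hoare_pre)
      apply (rule hoare_Seq hoare_SetReg)+
    subgoal for R
      using row Y2 pos by (simp add: at_defs rows_expr_def input_header)
    apply simp
    done
qed

lemma hoare_finish_eqn:
  assumes e: "e < length vs" and Y: "Y < (q ^ B) ^ k"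
  shows "hoare L input 2 (at_var N Y e n) finish_eqn (at_eqn N Y (Suc e))"
proof -
  let ?v = "vs ! e"
  have v: "?v \<in> sparse_vectors F n k" and bv: "b ?v < q"
    using e vs_sparse b_carrier[of ?v] by (auto simp: carrier_eq)
  have row: "input (4 + 2 * (q * q) + (e + e * n) + n) = b ?v"
    using input_row[OF e, of n] by simp
  have add0: "input (3 + b ?v) = 0 \<oplus> b ?v"
    using input_add[of 0 "b ?v"] bv q_ge_2 by simp
  have count: "count N Y (Suc e) = count N Y e + of_bool (agrees b N Y ?v)"
    using e by (rule count_Suc)
  have bounds: "Suc e < 2 ^ L" "count N Y (Suc e) < 2 ^ L"
    using size_less_2L e count_le by auto
  show ?thesis
    unfolding finish_eqn_def
    apply (rule hoare_pre)
      apply (rule hoare_Seq hoare_SetReg)+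
    subgoal for R
      using row add0 count bounds
      by (simp add: at_defs add_expr_def eval_both_equal_expr input_header agrees_def)
    apply simp
    done
qed

text \<open>Step counts keep the shape produced by \<open>hoare_Seq\<close> and
  \<open>hoare_For\<close>: set-up, loop, wrap-up.\<close>

definition "eqn_time = 6 + ((n * (8 + 1) + 1) + 2)"

lemma hoare_scan_eqn:
  assumes e: "e < length vs" and Y: "Y < (q ^ B) ^ k"
  shows "hoare L input eqn_time (at_eqn N Y e) scan_eqn (at_eqn N Y (Suc e))"
proof -
  have "hoare L input (n * (8 + 1) + 1) (at_var N Y e 0)
      (While (Minus n_expr (Reg r_var)) scan_var) (at_var N Y e n)"
    by (rule hoare_For, rule hoare_scan_var[OF e _ Y]) (auto simp: at_defs input_header)
  then show ?thesis
    unfolding scan_eqn_def eqn_time_def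
    by (rule hoare_Seq[OF hoare_Seq[OF hoare_finish_eqn[OF e Y]] hoare_start_eqn[OF e Y]])
qed

definition "assignment_time = 2 + ((length vs * (eqn_time + 1) + 1) + 2)"

lemma hoare_scan_assignment:
  assumes Y: "Y < (q ^ B) ^ k"
  shows "hoare L input assignment_time (at_assignment N Y) scan_assignment (at_assignment N (Suc Y))"
proof -
  have 1: "hoare L input 2 (at_assignment N Y)
      (Seq (SetReg r_count (Const 0)) (SetReg r_eqn (Const 0))) (at_eqn N Y 0)"
    apply (rule hoare_pre)
      apply (rule hoare_Seq hoare_SetReg)+
    subgoal for R by (simp add: at_defs count_def)
    apply simp
    done
  have best: "best (set vs) b N Y + (count N Y (length vs) - best (set vs) b N Y)
      = best (set vs) b N (Suc Y)"
    by (simp add: best_Suc count_def)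
  have bounds: "best (set vs) b N (Suc Y) < 2 ^ L" "Suc Y < 2 ^ L"
    using size_less_2L best_le_length less_2L(2) Y by auto
  have 2: "hoare L input 2 (at_eqn N Y (length vs))
      (Seq (SetReg r_best (Plus (Reg r_best) (Minus (Reg r_count) (Reg r_best))))
           (SetReg r_Y (Plus (Reg r_Y) (Const 1)))) (at_assignment N (Suc Y))"
    apply (rule hoare_pre)
      apply (rule hoare_Seq hoare_SetReg)+
    subgoal for R using best bounds by (simp add: at_defs)
    apply simp
    done
  have 3: "hoare L input (length vs * (eqn_time + 1) + 1) (at_eqn N Y 0)
      (While (Minus size_expr (Reg r_eqn)) scan_eqn) (at_eqn N Y (length vs))"
    by (rule hoare_For, rule hoare_scan_eqn[OF _ Y])
      (auto simp: at_defs size_expr_def input_header input_size)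
  show ?thesis
    unfolding scan_assignment_def assignment_time_def
    by (rule hoare_Seq[OF hoare_Seq[OF 2 3] 1])
qed

definition "class_time = 2 + (((q ^ B) ^ k * (assignment_time + 1) + 1) + 2)"

lemma hoare_scan_class:
  assumes N: "N < M ^ k"
  shows "hoare L input class_time (at_class N) (scan_class k) (at_class (Suc N))"
proof -
  have 1: "hoare L input 2 (at_class N)
      (Seq (SetReg r_best (Const 0)) (SetReg r_Y (Const 0))) (at_assignment N 0)"
    apply (rule hoare_pre)
      apply (rule hoare_Seq hoare_SetReg)+
    subgoal for R by (simp add: at_defs best_def)
    apply simp
    done
  have bounds: "total (Suc N) < 2 ^ L" "Suc N < 2 ^ L"
    using size_less_2L total_le[of "Suc N"] less_2L(1) N by auto
  have total: "total (Suc N) = total N + best (set vs) b N ((q ^ B) ^ k)"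
    by (simp add: total_def)
  have 2: "hoare L input 2 (at_assignment N ((q ^ B) ^ k))
      (Seq (SetReg r_total (Plus (Reg r_total) (Reg r_best)))
           (SetReg r_N (Plus (Reg r_N) (Const 1)))) (at_class (Suc N))"
    apply (rule hoare_pre)
      apply (rule hoare_Seq hoare_SetReg)+
    subgoal for R using bounds total by (simp add: at_defs)
    apply simp
    done
  have 3: "hoare L input ((q ^ B) ^ k * (assignment_time + 1) + 1) (at_assignment N 0)
      (While (Minus (power_expr (Reg r_Q) k) (Reg r_Y)) scan_assignment)
      (at_assignment N ((q ^ B) ^ k))"
    by (rule hoare_For, rule hoare_scan_assignment) (auto simp: at_defs eval_power_expr)
  show ?thesis
    unfolding scan_class_def class_time_def
    by (rule hoare_Seq[OF hoare_Seq[OF 2 3] 1])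
qed

definition "refute_time = 3 + ((B * (2 + 1) + 1) + ((M ^ k * (class_time + 1) + 1) + 1))"

lemma hoare_refute:
  "hoare L input refute_time (\<lambda>R. R = (\<lambda>_. 0)) (refutation_prog k)
     (\<lambda>R. R r_total = total (M ^ k) \<and> R r_denom = max (length vs) 1)"
proof -
  \<comment> \<open>Invariant of the loop that computes \<open>q ^ B\<close>, with
    \<open>r_var\<close> as the exponent reached.\<close>
  define at_power where "at_power i R \<longleftrightarrow> R r_B = B \<and> R r_M = M \<and> R r_Q = q ^ i \<and>
    R r_var = i \<and> R r_N = 0 \<and> R r_total = 0" for i and R :: "nat \<Rightarrow> nat"
  have M: "M < 2 ^ L"
    using power_k_ge[of M 1] k_pos M_pos by (intro less_2L(1)) simp
  have pos: "1 < (2::nat) ^ L"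
    using qn_ge(2) L_bounds(1) by auto
  have Q: "q ^ i < 2 ^ L" if "i \<le> B" for i
  proof -
    have "q ^ i \<le> (q ^ B) ^ 1"
      using that q_ge_2 by (simp add: power_increasing)
    also have "\<dots> \<le> (q ^ B) ^ k"
      using q_ge_2 k_pos by (intro power_increasing) auto
    finally show ?thesis by (rule less_2L(2))
  qed
  have 1: "hoare L input 3 (\<lambda>R. R = (\<lambda>_. 0))
      (Seq (SetReg r_B (Div l_expr (Const k)))
         (Seq (SetReg r_M (Plus (Div n_expr (Reg r_B)) (Const 1)))
              (SetReg r_Q (Const 1)))) (at_power 0)"
    apply (rule hoare_pre)
      apply (rule hoare_Seq hoare_SetReg)+
    subgoal for R
      using M pos B_less_2L by (simp add: at_power_def input_header B_def[symmetric] M_def)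
    apply simp
    done
  have 2: "hoare L input 2 (at_power i)
      (Seq (SetReg r_Q (Times (Reg r_Q) q_expr)) (SetReg r_var (Plus (Reg r_var) (Const 1))))
      (at_power (Suc i))" if "i < B" for i
    apply (rule hoare_pre)
      apply (rule hoare_Seq hoare_SetReg)+
    subgoal for R
      using Q[of "Suc i"] B_less_2L that by (simp add: at_power_def input_header mult.commute)
    apply simp
    done
  have 3: "hoare L input 1 (at_class (M ^ k))
      (SetReg r_denom (Plus size_expr (Minus (Const 1) size_expr)))
      (\<lambda>R. R r_total = total (M ^ k) \<and> R r_denom = max (length vs) 1)"
    apply (rule hoare_pre)
      apply (rule hoare_SetReg)
    subgoal for R
      using pos size_less_2L[of "length vs"]
      by (auto simp: at_defs size_expr_def input_header input_size)
    apply simp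
    done
  \<comment> \<open>\<open>at_class\<close> leaves \<open>r_var\<close> open; it is reset at the
    start of each equation.\<close>
  have init: "at_power B R \<Longrightarrow> at_class 0 R" for R
    by (simp add: at_power_def at_class_def total_def)
  have 4: "hoare L input (M ^ k * (class_time + 1) + 1) (at_class 0)
      (While (Minus (power_expr (Reg r_M) k) (Reg r_N)) (scan_class k)) (at_class (M ^ k))"
    by (rule hoare_For, rule hoare_scan_class) (auto simp: at_defs eval_power_expr)
  have 5: "hoare L input (B * (2 + 1) + 1) (at_power 0)
      (While (Minus (Reg r_B) (Reg r_var))
        (Seq (SetReg r_Q (Times (Reg r_Q) q_expr)) (SetReg r_var (Plus (Reg r_var) (Const 1)))))
      (at_power B)"
    by (rule hoare_For, rule 2) (auto simp: at_power_def)
  show ?thesis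
    unfolding refutation_prog_def refute_time_def
    by (rule hoare_Seq[OF hoare_Seq[OF hoare_pre[OF hoare_Seq[OF 3 4]] 5] 1])
      (use init in auto)
qed

lemma refute_outputs:
  assumes "affordable K (refutation_prog k)"
  shows "outputs_within (refutation_prog k) (encode F n l vs b) (alg_val (set vs, b)) (refute_time * (K * L))"
proof -
  have "1 \<le> L" using L_bounds(1) qn_ge(2) by (cases L) auto
  moreover have "confined L (conf input (\<lambda>_. 0))"
    using input_less_2L by (simp add: confined_def)
  ultimately obtain t R where R: "exec (refutation_prog k) (conf input (\<lambda>_. 0)) t (conf input R)"
    "t \<le> refute_time * (K * L)" "R r_total = total (M ^ k)" "R r_denom = max (length vs) 1"
    using hoareD[OF hoare_refute _ assms] by blast
  have "initial (encode F n l vs b) = conf input (\<lambda>_. 0)"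
    by (simp add: input_def initial_def)
  moreover have "alg_val (set vs, b) = real (total (M ^ k)) / real (max (length vs) 1)"
  proof (cases "vs = []")
    \<comment> \<open>Both values are 0 although the denominators differ: \<open>alg_val\<close>
      divides by 0, the machine by 1.\<close>
    case True
    then have "total (M ^ k) = 0" using total_le[of "M ^ k"] by simp
    with True show ?thesis by (simp add: alg_val_def)
  next
    case False
    then show ?thesis
      by (simp add: alg_val_def total_def distinct_card[OF distinct_vs] max_absorb1 Suc_le_eq)
  qed
  ultimately show ?thesis
    unfolding outputs_within_def using R by (intro exI[of _ t] exI[of _ "conf input R"]) simp
qed

end

section \<open>The running time\<close>

text \<open>One level of nesting: \<open>a\<close> rounds with their guard tests, and 5 steps for
  set-up, final test and wrap-up. This is at most \<open>5 + 2 * p ^ (i + 1)\<close>, and two more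
  factors \<open>p \<ge> 4\<close> absorb the constants.\<close>

lemma loop_time_le:
  fixes p :: nat
  assumes p: "4 \<le> p" and a: "a \<le> p" and t: "t \<le> p ^ i"
  shows "5 + a * (t + 1) \<le> p ^ (i + 3)"
proof -
  have "1 \<le> p ^ i" using p by simp
  have "a * (t + 1) \<le> p * (p ^ i + 1)" using a t by (intro mult_le_mono) auto
  also have "\<dots> \<le> p * (2 * p ^ i)" using \<open>1 \<le> p ^ i\<close> by (intro mult_le_mono2) linarith
  also have "\<dots> \<le> 2 * p ^ (i + 1)" by simp
  finally have "5 + a * (t + 1) \<le> 5 + 2 * p ^ (i + 1)" by simp
  moreover have "4 \<le> p ^ (i + 1)"
    using p \<open>1 \<le> p ^ i\<close> mult_le_mono[of 4 p 1 "p ^ i"] by simp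
  moreover have "16 * p ^ (i + 1) \<le> p ^ 2 * p ^ (i + 1)"
    using p mult_le_mono[of 4 p 4 p] by (intro mult_le_mono1) (simp add: power2_eq_square)
  moreover have "p ^ 2 * p ^ (i + 1) = p ^ (i + 3)"
    by (simp add: power2_eq_square power3_eq_cube power_add)
  ultimately show ?thesis by linarith
qed

context block_refutation
begin

text \<open>A sparse vector is determined by the list of its \<open>k\<close> nonzero positions with
  their values. This bounds the length of the input.\<close>

lemma card_sparse_le: "card (sparse_vectors F n k) \<le> (q * n) ^ k"
proof -
  let ?L = "{xs :: (nat \<times> nat) list. set xs \<subseteq> {..<n} \<times> {..<q} \<and> length xs = k}"
  \<comment> \<open>Rebuilds a vector from such a list, with the field's zero at all other
    positions.\<close>
  define f where "f xs = (\<lambda>i\<in>{..<n}. case map_of xs i of None \<Rightarrow> \<zero> | Some y \<Rightarrow> y)"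
    for xs :: "(nat \<times> nat) list"
  have "sparse_vectors F n k \<subseteq> f ` ?L"
  proof
    fix v assume v: "v \<in> sparse_vectors F n k"
    define I where "I = sorted_list_of_set {i \<in> {..<n}. v i \<noteq> \<zero>}"
    have I: "set I = {i \<in> {..<n}. v i \<noteq> \<zero>}" "length I = k"
      using v by (simp_all add: I_def sparse_vectors_def)
    have "map (\<lambda>i. (i, v i)) I \<in> ?L"
      using I sparse_closed[OF v] by (auto simp: carrier_eq)
    then have "f (map (\<lambda>i. (i, v i)) I) \<in> f ` ?L" by (rule imageI)
    moreover have "f (map (\<lambda>i. (i, v i)) I) = v"
    proof
      fix i
      have "map_of (map (\<lambda>i. (i, v i)) I) i = (if i \<in> set I then Some (v i) else None)"
        by (simp add: map_of_map_restrict restrict_map_def)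
      moreover have "v i = undefined" if "\<not> i < n"
        using v that by (auto simp: sparse_vectors_def vectors_def PiE_def extensional_def)
      ultimately show "f (map (\<lambda>i. (i, v i)) I) i = v i"
        using I(1) by (auto simp: f_def)
    qed
    ultimately show "v \<in> f ` ?L" by (simp only:)
  qed
  moreover have fin: "finite ?L" by (rule finite_lists_length_eq) simp
  ultimately have "card (sparse_vectors F n k) \<le> card (f ` ?L)"
    by (intro card_mono) auto
  also have "\<dots> \<le> card ?L" using fin by (rule card_image_le)
  also have "\<dots> = (q * n) ^ k"
    by (subst card_lists_length_eq) (auto simp: card_cartesian_product mult.commute)
  finally show ?thesis .
qed

text \<open>Everything is compared with \<open>p = (q * n) ^ l\<close>: at most
  \<open>p ^ 13\<close> steps cost at most \<open>K * L\<close> each, where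
  \<open>K \<le> p ^ K\<close> and \<open>L \<le> p ^ 4\<close>.\<close>

lemma computes_alg_val:
  assumes K: "affordable K (refutation_prog k)"
  shows "computes_within (refutation_prog k) F n k l alg_val ((q * n) ^ ((K + 17) * l))"
  unfolding computes_within_def
proof clarify
  fix b vs
  assume I: "(set vs, b) \<in> LIN_instances F n k" and vs: "distinct vs"
  define p where "p = (q * n) ^ l"
  let ?m = "length vs"
  \<comment> \<open>A generous bit length: each summand is below \<open>2 ^ L\<close>, and
    \<open>L\<close> is still polynomial in \<open>p\<close>.\<close>
  define L where "L = n + M ^ k + (q ^ B) ^ k + (4 + 2 * (q * q) + ?m * (n + 1))"
  have lt: "x < 2 ^ L" if "x \<le> L" for x
    using that less_exp[of L] by (rule le_less_trans)
  interpret refutation_input F n l k vs b L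
  proof unfold_locales
    show "distinct vs" by (rule vs)
    show "set vs \<subseteq> sparse_vectors F n k" "\<And>v. v \<in> set vs \<Longrightarrow> b v \<in> carrier F"
      using I by (auto simp: LIN_instances_def)
    show "n < 2 ^ L" "M ^ k < 2 ^ L" "(q ^ B) ^ k < 2 ^ L" "4 + 2 * (q * q) + ?m * (n + 1) < 2 ^ L"
      by (rule lt; simp add: L_def)+
  qed
  have l: "1 \<le> l" using k_pos k_le_l by simp
  have X: "n + 1 \<le> q * n" "q \<le> q * n" "4 \<le> q * n"
    using qn_ge mult_le_mono[OF q_ge_2 qn_ge(2)] by auto
  have "q * n = (q * n) ^ 1" by simp
  also have "\<dots> \<le> p" unfolding p_def using X l by (intro power_increasing) linarith+
  finally have Xp: "q * n \<le> p" .
  then have p: "4 \<le> p" "n + 1 \<le> p" "q \<le> p" using X by linarith+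
  have Mp: "M ^ k \<le> p" "(q ^ B) ^ k \<le> p"
    unfolding p_def by (rule M_power_le Q_power_le)+
  have "?m = card (set vs)" using vs by (simp add: distinct_card)
  also have "\<dots> \<le> card (sparse_vectors F n k)"
    using vs_sparse finite_sparse by (intro card_mono)
  also have "\<dots> \<le> (q * n) ^ k" by (rule card_sparse_le)
  also have "\<dots> \<le> p" unfolding p_def using X k_le_l by (intro power_increasing) linarith+
  finally have m: "?m \<le> p" .
  have "B \<le> n" using l_le_n div_le_dividend[of l k] unfolding B_def by linarith
  then have Bp: "B \<le> p" using p by linarith
  have p2: "4 * p \<le> p ^ 2" using p(1) by (simp add: power2_eq_square)
  have "L \<le> p ^ 4"
  proof -
    have "q * q \<le> p ^ 2"
      unfolding power2_eq_square using p(3) p(3) by (rule mult_le_mono)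
    moreover have "?m * (n + 1) \<le> p ^ 2"
      unfolding power2_eq_square using m p(2) by (rule mult_le_mono)
    ultimately have "L \<le> 5 * p ^ 2" using Mp p p2 unfolding L_def by linarith
    also have "\<dots> \<le> p ^ 2 * p ^ 2" using p(1) p2 by (intro mult_le_mono1) linarith
    finally show ?thesis by (simp flip: power_add)
  qed
  moreover have "K \<le> p ^ K"
  proof -
    have "K < 2 ^ K" by (rule less_exp)
    also have "(2::nat) ^ K \<le> p ^ K" using p by (intro power_mono) auto
    finally show ?thesis by simp
  qed
  \<comment> \<open>The loops over equations, assignments and classes raise the exponent from 3 to
    6, 9 and 12.\<close>
  moreover have "refute_time \<le> p ^ 13"
  proof -
    have "9 * p \<le> p ^ 3"
      using p(1) mult_le_mono[of 4 p 4 p] by (simp add: power3_eq_cube)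
    then have "eqn_time \<le> p ^ 3" using p unfolding eqn_time_def by simp
    then have "assignment_time \<le> p ^ 6"
      using loop_time_le[OF p(1) m, of eqn_time 3] by (simp add: assignment_time_def)
    then have "class_time \<le> p ^ 9"
      using loop_time_le[OF p(1) Mp(2), of assignment_time 6] by (simp add: class_time_def)
    then have "5 + M ^ k * (class_time + 1) \<le> p ^ 12"
      using loop_time_le[OF p(1) Mp(1), of class_time 9] by simp
    moreover have "1 + 3 * B \<le> p ^ 12"
    proof -
      have "1 + 3 * B \<le> p ^ 2" using Bp p p2 by linarith
      also have "\<dots> \<le> p ^ 12" using p by (intro power_increasing) auto
      finally show ?thesis .
    qed
    ultimately have "refute_time \<le> 2 * p ^ 12" by (simp add: refute_time_def)
    also have "\<dots> \<le> p * p ^ 12" using p by (intro mult_le_mono1) simp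
    finally show ?thesis by (simp flip: power_Suc)
  qed
  ultimately have "refute_time * (K * L) \<le> p ^ 13 * (p ^ K * p ^ 4)"
    by (intro mult_le_mono)
  also have "\<dots> = p ^ (K + 17)" by (simp add: ac_simps flip: power_add)
  also have "\<dots> = (q * n) ^ ((K + 17) * l)"
    by (simp add: p_def mult.commute flip: power_mult)
  finally show "outputs_within (refutation_prog k) (encode F n l vs b) (alg_val (set vs, b))
      ((q * n) ^ ((K + 17) * l))"
    using refute_outputs[OF K] unfolding outputs_within_def by (meson order_trans)
qed

end

section \<open>The refutation theorem with explicit constants\<close>

theorem theorem1p5:
  fixes k :: nat
  assumes "k \<ge> 2"
  shows "\<exists>(C::real) (c::nat) (d::nat). C > 0 \<and> d \<ge> 1 \<and>
    (\<forall>\<epsilon>::real. 0 < \<epsilon> \<and> \<epsilon> < 1 \<longrightarrow> (\<exists>P::prog.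
      \<forall>(F::nat ring) (n::nat) (l::nat). finite_field F \<and> real n / 2 \<ge> real l \<and> l \<ge> k \<longrightarrow>
        (\<exists>alg_val :: LIN \<Rightarrow> real.
          computes_within P F n k l alg_val ((field_size F * n) ^ (c * l)) \<and>
          (\<forall>I \<in> LIN_instances F n k. 0 \<le> alg_val I \<and> alg_val I \<le> 1) \<and>
          (\<forall>I \<in> LIN_instances F n k. alg_val I \<ge> LIN_val F n I) \<and>
          (\<forall>m. m \<le> card (sparse_vectors F n k) \<and>
               real m \<ge> C * real n * (real n / real l) ^ (k - 1)
                          * ln (real (field_size F * n)) * (1 / \<epsilon> ^ 2) \<longrightarrow>
             measure_pmf.prob (random_LIN F n k m)
               {I. alg_val I \<le> 1 / real (field_size F) + \<epsilon>} \<ge> 1 - 1 / real n ^ d) \<and>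
          (\<forall>H. H \<subseteq> sparse_vectors F n k \<and>
               real (card H) \<ge> C * real n * (real n / real l) ^ (k - 1)
                                 * ln (real (field_size F * n)) * (1 / \<epsilon> ^ 3) \<longrightarrow>
             measure_pmf.prob (semirandom_LIN F H)
               {I. alg_val I \<le> 1 / real (field_size F) + \<epsilon>} \<ge> 1 - 1 / real n ^ d))))"
proof -
  obtain K where K: "affordable K (refutation_prog k)"
    using affordable_exists by blast
  \<comment> \<open>The 2 stems from the choice of \<open>t\<close> in
    \<open>semirandom_bound\<close>, the power from bounding the number of classes by
    \<open>(4 * k * n / l) ^ k\<close>.\<close>
  let ?C = "2 * (4 * real k) ^ k"
  show ?thesis
  proof (rule exI[of _ ?C], rule exI[of _ "K + 17"], rule exI[of _ 1], intro conjI allI impI)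
    show "0 < ?C" using assms by simp
    fix \<epsilon> :: real assume \<epsilon>: "0 < \<epsilon> \<and> \<epsilon> < 1"
    show "\<exists>P. \<forall>F n l. finite_field F \<and> real n / 2 \<ge> real l \<and> l \<ge> k \<longrightarrow>
        (\<exists>alg_val.
          computes_within P F n k l alg_val ((field_size F * n) ^ ((K + 17) * l)) \<and>
          (\<forall>I \<in> LIN_instances F n k. 0 \<le> alg_val I \<and> alg_val I \<le> 1) \<and>
          (\<forall>I \<in> LIN_instances F n k. alg_val I \<ge> LIN_val F n I) \<and>
          (\<forall>m. m \<le> card (sparse_vectors F n k) \<and>
               real m \<ge> ?C * real n * (real n / real l) ^ (k - 1)
                          * ln (real (field_size F * n)) * (1 / \<epsilon> ^ 2) \<longrightarrow>
             measure_pmf.prob (random_LIN F n k m)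
               {I. alg_val I \<le> 1 / real (field_size F) + \<epsilon>} \<ge> 1 - 1 / real n ^ 1) \<and>
          (\<forall>H. H \<subseteq> sparse_vectors F n k \<and>
               real (card H) \<ge> ?C * real n * (real n / real l) ^ (k - 1)
                                 * ln (real (field_size F * n)) * (1 / \<epsilon> ^ 3) \<longrightarrow>
             measure_pmf.prob (semirandom_LIN F H)
               {I. alg_val I \<le> 1 / real (field_size F) + \<epsilon>} \<ge> 1 - 1 / real n ^ 1))"
    proof (rule exI[of _ "refutation_prog k"], intro allI impI, goal_cases)
      case (1 F n l)
      then interpret block_refutation F n l k
        using assms by unfold_locales auto
      \<comment> \<open>As \<epsilon> < 1, the size required in the semirandom case implies the one
        in \<open>semirandom_bound\<close>.\<close>
      have \<epsilon>3: "1 / \<epsilon> ^ 2 \<le> 1 / \<epsilon> ^ 3"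
        using \<epsilon> by (intro divide_left_mono power_decreasing) auto
      have "1 \<le> real (q * n)" using qn_ge by linarith
      then have "0 \<le> ?C * real n * (real n / real l) ^ (k - 1) * ln (real (q * n))"
        by (intro mult_nonneg_nonneg ln_ge_zero) auto
      note mono = mult_left_mono[OF \<epsilon>3 this]
      show ?case
      proof (rule exI[of _ alg_val], intro conjI allI impI ballI, goal_cases)
        case 1
        show ?case using computes_alg_val[OF K] by (simp only: q_def)
      next
        case (2 I)
        show ?case by (rule alg_val_nonneg)
      next
        case (3 I)
        then show ?case using alg_val_le_1 by (cases I) auto
      next
        case (4 I)
        then show ?case using LIN_val_le_alg_val by (cases I) auto
      next
        case (5 m)
        then show ?case
          using random_bound[of m \<epsilon>] \<epsilon> by (simp only: q_def power_one_right)
      next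
        case (6 H)
        then have "?C * real n * (real n / real l) ^ (k - 1) * ln (real (q * n)) * (1 / \<epsilon> ^ 2)
            \<le> real (card H)"
          using mono by (simp only: q_def) linarith
        then show ?case
          using semirandom_bound[of H \<epsilon>] 6 \<epsilon> by (simp only: q_def power_one_right)
      qed
    qed
  qed simp
qed

end
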